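(* Let $\xi,\eta\in L_G^1(\Omega)$. Then $\Gamma\big(\mathcal{P}_{\{\xi+\varepsilon\eta\}},\mathcal{P}_{\{\xi\}}\big)\to0$ as $\varepsilon\downarrow0$.
   Context: Fix $T>0$ and $0<\underline\sigma^2\le\overline\sigma^2<\infty$; $G(a)=\frac12(\overline\sigma^2a^+-\underline\sigma^2a^-)$. $\Omega=C([0,T];\mathbb{R})$ with the uniform distance and Borel $\sigma$-field $\mathcal{B}(\Omega)$; $B$ is the coordinate process; $L_{ip}(\Omega)$ is the set of random variables $\varphi(B_{t_1},B_{t_2}-B_{t_1},\dots,B_{t_n}-B_{t_{n-1}})$ with $n\ge1$, $0\le t_1<\dots<t_n\le T$, $\varphi$ bounded Lipschitz. $\hat{\mathbb{E}}$ is the $G$-expectation, i.e. the sublinear expectation on $L_{ip}(\Omega)$ under which $B$ is a one-dimensional $G$-Brownian motion: $\hat{\mathbb{E}}[\varphi(B_{t_1},\dots,B_{t_n}-B_{t_{n-1}})]=\widetilde{\mathbb{E}}[\varphi(\sqrt{t_1}\xi_1,\dots,\sqrt{t_n-t_{n-1}}\xi_n)]$, where on some sublinear expectation space the $\xi_i$ are identically distributed and $G$-normal (with $\widetilde{\mathbb{E}}[\xi_i^2]=\overline\sigma^2$, $-\widetilde{\mathbb{E}}[-\xi_i^2]=\underline\sigma^2$), each $\xi_i$ independent of $(\xi_1,\dots,\xi_{i-1})$ in Peng's sense. $L_G^1(\Omega)$ is the completion of $L_{ip}(\Omega)$ under $\hat{\mathbb{E}}[|\cdot|]$. $\mathcal{P}=\{P\text{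 probability on }(\Omega,\mathcal{B}(\Omega)):E_P[X]\le\hat{\mathbb{E}}[X]\ \forall X\in L_G^1(\Omega)\}$; it is known to be nonempty, convex, weakly compact, with $\hat{\mathbb{E}}[\xi]=\max_{P\in\mathcal{P}}E_P[\xi]$ for all $\xi\in L_G^1(\Omega)$. For $\xi\in L_G^1(\Omega)$, $\mathcal{P}_{\{\xi\}}:=\{P\in\mathcal{P}:E_P[\xi]=\hat{\mathbb{E}}[\xi]\}$ (nonempty). $\mathcal{P}$ is endowed with a metric $d$ compatible with weak convergence of probability measures, e.g. $d(P,Q)=\sup\{\int_\Omega f\,d(P-Q):|f|_{BL}\le1\}$, $|f|_{BL}=\sup_\omega|f(\omega)|+\sup_{\omega\ne\omega'}\frac{|f(\omega)-f(\omega')|}{|\omega-\omega'|_{C([0,T])}}$. For $A,B\subset\mathcal{P}$: $d(P,B)=\inf\{d(P,Q):Q\in B\}$ and $\Gamma(A,B):=\sup_{P\in A}d(P,B)$. *)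

theory Defs
  imports "HOL-Probability.Probability"
begin

section \<open>Sublinear expectation spaces\<close>

text \<open>
  A function on \<open>\<real>\<^sup>n\<close> is a function on sequences \<^typ>\<open>nat \<Rightarrow> real\<close> that depends on the first \<open>n\<close>
  coordinates only; both estimates below force this dependence. \<open>L2_set x {..<n}\<close> is the Euclidean
  norm of \<open>(x 0, \<dots>, x (n - 1))\<close>.
\<close>

definition C_lLip :: "nat \<Rightarrow> ((nat \<Rightarrow> real) \<Rightarrow> real) set" where
  "C_lLip n = {\<phi>. \<exists>C k. \<forall>x y. \<bar>\<phi> x - \<phi> y\<bar> \<le>
      C * (1 + L2_set x {..<n} ^ k + L2_set y {..<n} ^ k) * L2_set (\<lambda>i. x i - y i) {..<n}}"

definition C_bLip :: "nat \<Rightarrow> ((nat \<Rightarrow> real) \<Rightarrow> real) set" where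
  "C_bLip n = {\<phi>. (\<exists>C. \<forall>x. \<bar>\<phi> x\<bar> \<le> C) \<and>
      (\<exists>C. \<forall>x y. \<bar>\<phi> x - \<phi> y\<bar> \<le> C * L2_set (\<lambda>i. x i - y i) {..<n})}"

definition sublinear_expectation ::
    "'w set \<Rightarrow> ('w \<Rightarrow> real) set \<Rightarrow> (('w \<Rightarrow> real) \<Rightarrow> real) \<Rightarrow> bool" where
  "sublinear_expectation W H E \<longleftrightarrow>
     (\<forall>c. (\<lambda>_. c) \<in> H) \<and>
     (\<forall>X\<in>H. \<forall>Y\<in>H. (\<lambda>w. X w + Y w) \<in> H) \<and>
     (\<forall>X\<in>H. \<forall>c. (\<lambda>w. c * X w) \<in> H) \<and>
     (\<forall>X\<in>H. (\<lambda>w. \<bar>X w\<bar>) \<in> H) \<and>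
     (\<forall>X\<in>H. \<forall>Y\<in>H. (\<forall>w\<in>W. X w \<le> Y w) \<longrightarrow> E X \<le> E Y) \<and>
     (\<forall>c. E (\<lambda>_. c) = c) \<and>
     (\<forall>X\<in>H. \<forall>Y\<in>H. E (\<lambda>w. X w + Y w) \<le> E X + E Y) \<and>
     (\<forall>X\<in>H. \<forall>c\<ge>0. E (\<lambda>w. c * X w) = c * E X)"

definition sublinear_expectation_space ::
    "'w set \<Rightarrow> ('w \<Rightarrow> real) set \<Rightarrow> (('w \<Rightarrow> real) \<Rightarrow> real) \<Rightarrow> bool" where
  "sublinear_expectation_space W H E \<longleftrightarrow>
     sublinear_expectation W H E \<and>
     (\<forall>n X \<phi>. (\<forall>i<n. X i \<in> H) \<and> \<phi> \<in> C_lLip n \<longrightarrow> (\<lambda>w. \<phi> (\<lambda>i. X i w)) \<in> H)"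

definition identically_distributed ::
    "(('w \<Rightarrow> real) \<Rightarrow> real) \<Rightarrow> ('w \<Rightarrow> real) \<Rightarrow> ('w \<Rightarrow> real) \<Rightarrow> bool" where
  "identically_distributed E X Y \<longleftrightarrow>
     (\<forall>\<phi>\<in>C_lLip 1. E (\<lambda>w. \<phi> (\<lambda>_. X w)) = E (\<lambda>w. \<phi> (\<lambda>_. Y w)))"

text \<open>Peng's (asymmetric) independence of \<open>Y\<close> from the vector \<open>(X 0, \<dots>, X (m - 1))\<close>.\<close>

definition independent_from ::
    "(('w \<Rightarrow> real) \<Rightarrow> real) \<Rightarrow> ('w \<Rightarrow> real) \<Rightarrow> nat \<Rightarrow> (nat \<Rightarrow> 'w \<Rightarrow> real) \<Rightarrow> bool" where
  "independent_from E Y m X \<longleftrightarrow>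
     (\<forall>\<phi>\<in>C_lLip (Suc m).
        E (\<lambda>w. \<phi> ((\<lambda>i. X i w)(m := Y w))) = E (\<lambda>w. E (\<lambda>v. \<phi> ((\<lambda>i. X i w)(m := Y v)))))"

text \<open>
  \<open>X\<close> is G-normal for \<open>G a = (\<sigma>u\<^sup>2 * a\<^sup>+ - \<sigma>l\<^sup>2 * a\<^sup>-) / 2\<close>, that is \<open>G a = E (a * X\<^sup>2) / 2\<close>;
  \<open>Y\<close> is an independent copy of \<open>X\<close>.
\<close>

definition G_normal ::
    "real \<Rightarrow> real \<Rightarrow> ('w \<Rightarrow> real) set \<Rightarrow> (('w \<Rightarrow> real) \<Rightarrow> real) \<Rightarrow> ('w \<Rightarrow> real) \<Rightarrow> bool" where
  "G_normal \<sigma>l \<sigma>u H E X \<longleftrightarrow>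
     X \<in> H \<and>
     (\<exists>Y\<in>H. identically_distributed E Y X \<and> independent_from E Y 1 (\<lambda>_. X) \<and>
        (\<forall>a\<ge>0. \<forall>b\<ge>0. identically_distributed E
            (\<lambda>w. a * X w + b * Y w) (\<lambda>w. sqrt (a\<^sup>2 + b\<^sup>2) * X w))) \<and>
     E (\<lambda>w. (X w)\<^sup>2) = \<sigma>u\<^sup>2 \<and> - E (\<lambda>w. - (X w)\<^sup>2) = \<sigma>l\<^sup>2"

definition G_normal_iid ::
    "real \<Rightarrow> real \<Rightarrow> 'w set \<Rightarrow> ('w \<Rightarrow> real) set \<Rightarrow> (('w \<Rightarrow> real) \<Rightarrow> real) \<Rightarrow> (nat \<Rightarrow> 'w \<Rightarrow> real) \<Rightarrow> bool"
where
  "G_normal_iid \<sigma>l \<sigma>u W H E \<zeta> \<longleftrightarrow>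
     sublinear_expectation_space W H E \<and>
     (\<forall>i. G_normal \<sigma>l \<sigma>u H E (\<zeta> i)) \<and>
     (\<forall>i j. identically_distributed E (\<zeta> i) (\<zeta> j)) \<and>
     (\<forall>i. independent_from E (\<zeta> i) i \<zeta>)"


section \<open>Path space and G-expectation\<close>

type_synonym path = "real \<Rightarrow> real"
type_synonym rv = "path \<Rightarrow> real"

text \<open>Elements of \<open>C([0,T])\<close> are functions on the reals with the value \<^const>\<open>undefined\<close> off \<open>[0,T]\<close>.\<close>

definition path_metric :: "real \<Rightarrow> path metric" where
  "path_metric T = cfunspace (top_of_set {0..T}) euclidean_metric"

abbreviation \<Omega> :: "real \<Rightarrow> path set" where
  "\<Omega> T \<equiv> mspace (path_metric T)"

definition path_borel :: "real \<Rightarrow> path measure" where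
  "path_borel T = sigma (\<Omega> T) {U. openin (mtopology_of (path_metric T)) U}"

text \<open>The vector \<open>(\<omega> (t 0), \<omega> (t 1) - \<omega> (t 0), \<omega> (t 2) - \<omega> (t 1), \<dots>)\<close>.\<close>

definition increments :: "(nat \<Rightarrow> real) \<Rightarrow> path \<Rightarrow> nat \<Rightarrow> real" where
  "increments t \<omega> i = (if i = 0 then \<omega> (t 0) else \<omega> (t i) - \<omega> (t (i - 1)))"

definition time_grid :: "real \<Rightarrow> nat \<Rightarrow> (nat \<Rightarrow> real) \<Rightarrow> bool" where
  "time_grid T n t \<longleftrightarrow> 1 \<le> n \<and> strict_mono_on {..<n} t \<and> t ` {..<n} \<subseteq> {0..T}"

definition L_ip :: "real \<Rightarrow> rv set" where
  "L_ip T = {\<lambda>\<omega>. \<phi> (increments t \<omega>) | n t \<phi>. time_grid T n t \<and> \<phi> \<in> C_bLip n}"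

text \<open>
  \<open>E\<close> is the G-expectation on \<^term>\<open>L_ip T\<close>, with finite-dimensional laws read off from the
  G-normal sequence \<open>\<zeta>\<close> on the auxiliary space \<open>(W, H, E')\<close>. The factors \<open>increments t (\<lambda>s. s) i\<close>
  under the root are the time steps \<open>t 0, t 1 - t 0, \<dots>\<close>. Only the values of \<open>E\<close> on
  \<^term>\<open>L_ip T\<close> are constrained, and only those are used.
\<close>

definition G_expectation ::
    "real \<Rightarrow> real \<Rightarrow> real \<Rightarrow> 'w set \<Rightarrow> ('w \<Rightarrow> real) set \<Rightarrow> (('w \<Rightarrow> real) \<Rightarrow> real) \<Rightarrow>
     (nat \<Rightarrow> 'w \<Rightarrow> real) \<Rightarrow> (rv \<Rightarrow> real) \<Rightarrow> bool" where
  "G_expectation T \<sigma>l \<sigma>u W H E' \<zeta> E \<longleftrightarrow>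
     G_normal_iid \<sigma>l \<sigma>u W H E' \<zeta> \<and>
     sublinear_expectation (\<Omega> T) (L_ip T) E \<and>
     (\<forall>n t \<phi>. time_grid T n t \<and> \<phi> \<in> C_bLip n \<longrightarrow>
        E (\<lambda>\<omega>. \<phi> (increments t \<omega>)) =
        E' (\<lambda>w. \<phi> (\<lambda>i. sqrt (increments t (\<lambda>s. s) i) * \<zeta> i w)))"


section \<open>The completion of \<open>L_ip\<close>\<close>

definition G_Cauchy :: "real \<Rightarrow> (rv \<Rightarrow> real) \<Rightarrow> (nat \<Rightarrow> rv) set" where
  "G_Cauchy T E = {X. (\<forall>n. X n \<in> L_ip T) \<and>
     (\<forall>e>0. \<exists>N. \<forall>m\<ge>N. \<forall>n\<ge>N. E (\<lambda>\<omega>. \<bar>X m \<omega> - X n \<omega>\<bar>) < e)}"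

definition G_rel :: "real \<Rightarrow> (rv \<Rightarrow> real) \<Rightarrow> (nat \<Rightarrow> rv) rel" where
  "G_rel T E = {(X, Y). X \<in> G_Cauchy T E \<and> Y \<in> G_Cauchy T E \<and>
     (\<lambda>n. E (\<lambda>\<omega>. \<bar>X n \<omega> - Y n \<omega>\<bar>)) \<longlonglongrightarrow> 0}"

definition L_G1 :: "real \<Rightarrow> (rv \<Rightarrow> real) \<Rightarrow> (nat \<Rightarrow> rv) set set" where
  "L_G1 T E = G_Cauchy T E // G_rel T E"

definition L_G1_add ::
    "real \<Rightarrow> (rv \<Rightarrow> real) \<Rightarrow> (nat \<Rightarrow> rv) set \<Rightarrow> (nat \<Rightarrow> rv) set \<Rightarrow> (nat \<Rightarrow> rv) set" where
  "L_G1_add T E \<xi> \<eta> = (\<Union>X\<in>\<xi>. \<Union>Y\<in>\<eta>. G_rel T E `` {\<lambda>n \<omega>. X n \<omega> + Y n \<omega>})"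

definition L_G1_scale ::
    "real \<Rightarrow> (rv \<Rightarrow> real) \<Rightarrow> real \<Rightarrow> (nat \<Rightarrow> rv) set \<Rightarrow> (nat \<Rightarrow> rv) set" where
  "L_G1_scale T E c \<xi> = (\<Union>X\<in>\<xi>. G_rel T E `` {\<lambda>n \<omega>. c * X n \<omega>})"

text \<open>
  Extension by continuity of a functional \<open>F\<close> on \<open>L_ip\<close> to an element of the completion. It gives
  meaning both to the G-expectation and to the linear expectations \<open>E\<^sub>P\<close> on the completion.
\<close>

definition has_extension :: "(rv \<Rightarrow> real) \<Rightarrow> (nat \<Rightarrow> rv) set \<Rightarrow> real \<Rightarrow> bool" where
  "has_extension F \<xi> l \<longleftrightarrow> (\<forall>X\<in>\<xi>. (\<lambda>n. F (X n)) \<longlonglongrightarrow> l)"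

definition extension :: "(rv \<Rightarrow> real) \<Rightarrow> (nat \<Rightarrow> rv) set \<Rightarrow> real" where
  "extension F \<xi> = (THE l. has_extension F \<xi> l)"


section \<open>The representing measures\<close>

text \<open>
  The first conjunct of the last condition says that \<open>E\<^sub>P \<xi>\<close> is well defined. It holds automatically
  once \<open>E\<^sub>P\<close> is dominated by \<open>E\<close> on \<open>L_ip\<close>; stating it keeps \<^const>\<open>The\<close> from being
  applied to a limit that does not exist.
\<close>

definition \<P> :: "real \<Rightarrow> (rv \<Rightarrow> real) \<Rightarrow> path measure set" where
  "\<P> T E = {P. prob_space P \<and> space P = \<Omega> T \<and> sets P = sets (path_borel T) \<and>
     (\<forall>X\<in>L_G1 T E. (\<exists>l. has_extension (integral\<^sup>L P) X l) \<and>
        extension (integral\<^sup>L P) X \<le> extension E X)}"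

definition \<P>_max :: "real \<Rightarrow> (rv \<Rightarrow> real) \<Rightarrow> (nat \<Rightarrow> rv) set \<Rightarrow> path measure set" where
  "\<P>_max T E \<xi> = {P \<in> \<P> T E. extension (integral\<^sup>L P) \<xi> = extension E \<xi>}"

definition weak_convergence :: "real \<Rightarrow> (nat \<Rightarrow> path measure) \<Rightarrow> path measure \<Rightarrow> bool" where
  "weak_convergence T Q P \<longleftrightarrow>
     (\<forall>f. continuous_map (mtopology_of (path_metric T)) euclideanreal f \<and> bounded (f ` \<Omega> T) \<longrightarrow>
        (\<lambda>n. integral\<^sup>L (Q n) f) \<longlonglongrightarrow> integral\<^sup>L P f)"

definition compatible_metric ::
    "real \<Rightarrow> path measure set \<Rightarrow> (path measure \<Rightarrow> path measure \<Rightarrow> real) \<Rightarrow> bool" where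
  "compatible_metric T S d \<longleftrightarrow> Metric_space S d \<and>
     (\<forall>Q P. (\<forall>n. Q n \<in> S) \<and> P \<in> S \<longrightarrow>
        ((\<lambda>n. d (Q n) P) \<longlonglongrightarrow> 0 \<longleftrightarrow> weak_convergence T Q P))"

text \<open>Suprema and infima of distances are taken in \<open>[0,\<infinity>]\<close>.\<close>

definition dist_to_set :: "('a \<Rightarrow> 'a \<Rightarrow> real) \<Rightarrow> 'a \<Rightarrow> 'a set \<Rightarrow> ennreal" where
  "dist_to_set d P B = (INF Q\<in>B. ennreal (d P Q))"

definition \<Gamma> :: "('a \<Rightarrow> 'a \<Rightarrow> real) \<Rightarrow> 'a set \<Rightarrow> 'a set \<Rightarrow> ennreal" where
  "\<Gamma> d A B = (SUP P\<in>A. dist_to_set d P B)"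

end

theory Submission
  imports Defs "HOL-Complex_Analysis.Great_Picard"
begin

text \<open>
  Suppose \<open>P\<^sub>k\<close> maximizes \<open>\<xi> + \<epsilon>\<^sub>k \<eta>\<close> with \<open>\<epsilon>\<^sub>k \<rightarrow> 0\<close> and stays at distance more than \<open>\<delta>\<close> from the
  maximizers of \<open>\<xi>\<close>. The fourth moment of the G-normal increments makes the representing measures
  tight by Kolmogorov's criterion, so a subsequence converges weakly to some \<open>Q\<close>, and \<open>Q\<close> is again
  dominated by the G-expectation. Since \<open>E\<^bsub>P\<^esub> \<xi>\<close> is weakly continuous in \<open>P\<close> and the perturbation
  changes every expectation by at most \<open>\<epsilon>\<^sub>k sup\<^sub>n E \<bar>Y\<^sub>n\<bar>\<close>, where \<open>Y\<close> represents \<open>\<eta>\<close>, the limit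
  \<open>Q\<close> maximizes \<open>\<xi>\<close>, a contradiction.
\<close>

subsection \<open>Path space\<close>

text \<open>The maximizing argument is soft; the work lies in the compactness of the representing
  measures. Prokhorov's theorem is reduced to the real line: a path is stored as a real number whose
  ternary digits answer the countably many questions whether its value at a rational time is at most
  a given rational. Laws of codes live on a bounded interval, so a convergent subsequence comes for
  free, and Skorohod's theorem makes the codes converge pointwise. The obstacle is that this code is
  injective and Borel but not continuous: a question whose threshold equals the value of the limit
  path can be answered either way in the limit. The decoder therefore reads a value as an infimum of
  thresholds, which ignores such borderline answers; on a compact set of paths, convergence of the
  codes then forces convergence of the paths. In the completion, the one estimate behind every limit
  is the contraction property in the seminorm
  \<open>E (\<lambda>\<omega>. \<bar>X \<omega>\<bar>)\<close>, shared by \<open>E\<close> and all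
  dominated integrals; it makes approximation by cylinder functions uniform over the
  measures.\<close>

lemma path_space_iff:
  "\<omega> \<in> \<Omega> T \<longleftrightarrow> \<omega> \<in> extensional {0..T} \<and> continuous_on {0..T} \<omega>"
proof -
  have "compactin (top_of_set {0..T}) (topspace (top_of_set {0..T}))"
    by (simp add: compactin_subtopology)
  from compactin_mspace_cfunspace[OF this, of "euclidean_metric :: real metric"] show ?thesis
    unfolding path_metric_def by (simp del: mspace_cfunspace)
qed

lemma restrict_in_path_space:
  assumes "continuous_on {0..T} f"
  shows "restrict f {0..T} \<in> \<Omega> T"
  unfolding path_space_iff using continuous_on_eq[OF assms, of "restrict f {0..T}"] by simp

lemma path_mdist_le_iff:
  assumes "0 \<le> T" "\<omega> \<in> \<Omega> T" "\<omega>' \<in> \<Omega> T"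
  shows "mdist (path_metric T) \<omega> \<omega>' \<le> e \<longleftrightarrow> (\<forall>t\<in>{0..T}. \<bar>\<omega> t - \<omega>' t\<bar> \<le> e)"
  using assms unfolding path_metric_def by (subst cfunspace_mdist_le) (auto simp: dist_real_def)

lemma path_diff_le_mdist:
  assumes "0 \<le> T" "\<omega> \<in> \<Omega> T" "\<omega>' \<in> \<Omega> T" "t \<in> {0..T}"
  shows "\<bar>\<omega> t - \<omega>' t\<bar> \<le> mdist (path_metric T) \<omega> \<omega>'"
  using path_mdist_le_iff[OF assms(1-3)] assms(4) by blast

lemma limitin_pathI:
  assumes "0 \<le> T" "\<omega> \<in> \<Omega> T" "\<And>n. w n \<in> \<Omega> T"
    and "\<And>e. e > 0 \<Longrightarrow> eventually (\<lambda>n. \<forall>t\<in>{0..T}. \<bar>w n t - \<omega> t\<bar> \<le> e) F"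
  shows "limitin (mtopology_of (path_metric T)) w \<omega> F"
proof -
  interpret Metric_space "\<Omega> T" "mdist (path_metric T)"
    by (rule Metric_space_mspace_mdist)
  have "eventually (\<lambda>n. mdist (path_metric T) (w n) \<omega> < e) F" if "e > 0" for e
  proof -
    have "eventually (\<lambda>n. \<forall>t\<in>{0..T}. \<bar>w n t - \<omega> t\<bar> \<le> e / 2) F"
      using assms(4)[of "e / 2"] that by linarith
    then show ?thesis
    proof eventually_elim
      case (elim n)
      then have "mdist (path_metric T) (w n) \<omega> \<le> e / 2"
        using path_mdist_le_iff assms by blast
      with that show ?case by simp
    qed
  qed
  then show ?thesis
    unfolding mtopology_of_def limitin_metric using assms by simp
qed

lemma limitin_path_coordinate:
  assumes "0 \<le> T" "limitin (mtopology_of (path_metric T)) w \<omega> F" "t \<in> {0..T}"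
  shows "((\<lambda>n. w n t) \<longlongrightarrow> \<omega> t) F"
proof -
  interpret Metric_space "\<Omega> T" "mdist (path_metric T)"
    by (rule Metric_space_mspace_mdist)
  have w: "\<omega> \<in> \<Omega> T" "eventually (\<lambda>n. w n \<in> \<Omega> T) F"
    "((\<lambda>n. mdist (path_metric T) (w n) \<omega>) \<longlongrightarrow> 0) F"
    using assms(2) unfolding mtopology_of_def limitin_metric_dist_null by auto
  have "((\<lambda>n. w n t - \<omega> t) \<longlongrightarrow> 0) F"
    by (rule Lim_null_comparison[OF _ w(3)])
      (use w(2) in eventually_elim, use assms w path_diff_le_mdist in auto)
  then show ?thesis
    by (simp add: LIM_zero_iff)
qed

lemma continuous_map_path_tendsto:
  assumes "continuous_map (mtopology_of (path_metric T)) euclideanreal f"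
    and "limitin (mtopology_of (path_metric T)) w \<omega> F"
  shows "((\<lambda>n. f (w n)) \<longlongrightarrow> f \<omega>) F"
  using continuous_map_limit[OF assms] by (simp add: limitin_canonical_iff o_def)

section \<open>Borel sets of path space and coordinate evaluations\<close>

lemma topspace_path [simp]: "topspace (mtopology_of (path_metric T)) = \<Omega> T"
  by simp

lemma openin_path_subset: "openin (mtopology_of (path_metric T)) U \<Longrightarrow> U \<subseteq> \<Omega> T"
  by (metis openin_subset topspace_path)

lemma path_borel_space [simp]: "space (path_borel T) = \<Omega> T"
  unfolding path_borel_def by (rule space_measure_of) (use openin_path_subset in auto)

lemma sets_path_borel:
  "sets (path_borel T) = sigma_sets (\<Omega> T) {U. openin (mtopology_of (path_metric T)) U}"
  unfolding path_borel_def by (rule sets_measure_of) (use openin_path_subset in auto)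

lemma path_continuous_measurable:
  assumes "continuous_map (mtopology_of (path_metric T)) euclideanreal f"
  shows "f \<in> borel_measurable (path_borel T)"
proof (rule borel_measurableI)
  fix S :: "real set" assume "open S"
  then have "openin (mtopology_of (path_metric T)) {x \<in> \<Omega> T. f x \<in> S}"
    using openin_continuous_map_preimage[OF assms, of S] by simp
  moreover have "f -` S \<inter> space (path_borel T) = {x \<in> \<Omega> T. f x \<in> S}"
    by auto
  ultimately show "f -` S \<inter> space (path_borel T) \<in> sets (path_borel T)"
    by (simp add: sets_path_borel)
qed

lemma path_evaluation_continuous:
  assumes "t \<in> {0..T}"
  shows "continuous_map (mtopology_of (path_metric T)) euclideanreal (\<lambda>\<omega>. \<omega> t)"
proof -
  interpret Metric_space "\<Omega> T" "mdist (path_metric T)"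
    by (rule Metric_space_mspace_mdist)
  have T: "0 \<le> T" using assms by simp
  have "Lipschitz_continuous_map (path_metric T) euclidean_metric (\<lambda>\<omega>. \<omega> t)"
    unfolding Lipschitz_continuous_map_def
    by (intro conjI exI[of _ 1]) (use path_diff_le_mdist[OF T _ _ assms] in \<open>auto simp: dist_real_def\<close>)
  then have "continuous_map (mtopology_of (path_metric T)) (mtopology_of euclidean_metric) (\<lambda>\<omega>. \<omega> t)"
    by (rule Lipschitz_continuous_imp_continuous_map)
  then show ?thesis by simp
qed

lemma path_evaluation_measurable:
  "t \<in> {0..T} \<Longrightarrow> (\<lambda>\<omega>. \<omega> t) \<in> borel_measurable (path_borel T)"
  by (intro path_continuous_measurable path_evaluation_continuous)

section \<open>Bernstein approximation of paths and measurability of path-valued maps\<close>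

definition bernstein_path :: "real \<Rightarrow> nat \<Rightarrow> (nat \<Rightarrow> real) \<Rightarrow> path" where
  "bernstein_path T n c = restrict (\<lambda>t. \<Sum>k\<le>n. c k * Bernstein n k (t / T)) {0..T}"

lemma bernstein_path_in: "0 < T \<Longrightarrow> bernstein_path T n c \<in> \<Omega> T"
  unfolding bernstein_path_def Bernstein_def
  by (intro restrict_in_path_space continuous_intros) auto

lemma bernstein_path_approx:
  assumes T: "0 < T" and w: "\<omega> \<in> \<Omega> T"
  shows "limitin (mtopology_of (path_metric T))
    (\<lambda>n. bernstein_path T n (\<lambda>k. \<omega> (T * (real k / real n)))) \<omega> sequentially"
proof (rule limitin_pathI)
  fix e :: real assume "e > 0"
  have "continuous_on {0..1} (\<lambda>s. \<omega> (T * s))"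
    by (rule continuous_on_compose2[of "{0..T}" \<omega>])
      (use w T in \<open>auto simp: path_space_iff mult_left_le intro: continuous_on_mult_left continuous_on_id\<close>)
  from Bernstein_Weierstrass[OF this \<open>e > 0\<close>] obtain N where
    N: "\<bar>\<omega> (T * x) - (\<Sum>k\<le>n. \<omega> (T * (real k / real n)) * Bernstein n k x)\<bar> < e"
    if "n \<ge> N" "x \<in> {0..1}" for n x by blast
  have "\<bar>bernstein_path T n (\<lambda>k. \<omega> (T * (real k / real n))) t - \<omega> t\<bar> \<le> e"
    if "n \<ge> N" "t \<in> {0..T}" for n t
    using N[OF that(1), of "t / T"] that(2) T by (simp add: bernstein_path_def field_simps abs_minus_commute)
  then show "\<forall>\<^sub>F n in sequentially. \<forall>t\<in>{0..T}.
      \<bar>bernstein_path T n (\<lambda>k. \<omega> (T * (real k / real n))) t - \<omega> t\<bar> \<le> e"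
    unfolding eventually_sequentially by blast
qed (use assms bernstein_path_in in auto)

text \<open>On [0,1] the Bernstein polynomials take values in [0,1], so the uniform distance is at
  most the sum of the \<open>n + 1\<close> coefficient differences. Coefficients enter as a free
  sequence so that this becomes continuity of a map on \<open>nat \<Rightarrow> real\<close> with
  the product topology.\<close>

lemma bernstein_path_tendsto:
  assumes T: "0 < T" and c: "\<And>k. (\<lambda>i. c i k) \<longlonglongrightarrow> c' k"
  shows "limitin (mtopology_of (path_metric T)) (\<lambda>i. bernstein_path T n (c i))
    (bernstein_path T n c') sequentially"
proof (rule limitin_pathI)
  fix e :: real assume "e > 0"
  have "(\<lambda>i. \<Sum>k\<le>n. \<bar>c i k - c' k\<bar>) \<longlonglongrightarrow> (\<Sum>k\<le>n. \<bar>c' k - c' k\<bar>)"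
    by (intro tendsto_intros c)
  then have "\<forall>\<^sub>F i in sequentially. (\<Sum>k\<le>n. \<bar>c i k - c' k\<bar>) < e"
    using \<open>e > 0\<close> by (auto dest: order_tendstoD(2))
  then show "\<forall>\<^sub>F i in sequentially. \<forall>t\<in>{0..T}. \<bar>bernstein_path T n (c i) t - bernstein_path T n c' t\<bar> \<le> e"
  proof eventually_elim
    case (elim i)
    show ?case
    proof
      fix t assume t: "t \<in> {0..T}"
      have B0: "0 \<le> Bernstein n k (t / T)" for k
        using t T by (intro Bernstein_nonneg) auto
      have B1: "Bernstein n k (t / T) \<le> 1" if "k \<le> n" for k
      proof -
        have "Bernstein n k (t / T) \<le> (\<Sum>k\<le>n. Bernstein n k (t / T))"
          using that B0 by (intro member_le_sum) auto
        then show ?thesis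
          by simp
      qed
      have "bernstein_path T n (c i) t - bernstein_path T n c' t
          = (\<Sum>k\<le>n. (c i k - c' k) * Bernstein n k (t / T))"
        using t by (simp add: bernstein_path_def sum_subtractf left_diff_distrib)
      also have "\<bar>\<dots>\<bar> \<le> (\<Sum>k\<le>n. \<bar>(c i k - c' k) * Bernstein n k (t / T)\<bar>)"
        by (rule sum_abs)
      also have "\<dots> \<le> (\<Sum>k\<le>n. \<bar>c i k - c' k\<bar>)"
        unfolding abs_mult using B0 B1 by (intro sum_mono mult_left_le) auto
      finally show "\<bar>bernstein_path T n (c i) t - bernstein_path T n c' t\<bar> \<le> e"
        using elim by simp
    qed
  qed
qed (use T bernstein_path_in in auto)

text \<open>Approximating by Bernstein polynomials makes a continuous functional of a path a limit of
  functions of finitely many coordinates; this replaces an argument by separability.\<close>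

lemma continuous_path_functional_measurable:
  assumes T: "0 < T" and F: "\<And>u. u \<in> space M \<Longrightarrow> F u \<in> \<Omega> T"
    and meas: "\<And>t. t \<in> {0..T} \<Longrightarrow> (\<lambda>u. F u t) \<in> borel_measurable M"
    and f: "continuous_map (mtopology_of (path_metric T)) euclideanreal f"
  shows "(\<lambda>u. f (F u)) \<in> borel_measurable M"
proof (rule borel_measurable_LIMSEQ_real)
  fix u assume "u \<in> space M"
  then show "(\<lambda>n. f (bernstein_path T n (\<lambda>k. F u (T * (real (min k n) / real n))))) \<longlonglongrightarrow> f (F u)"
  proof -
    \<comment> \<open>Only coefficients with \<open>k \<le> n\<close> enter; \<open>min k n\<close>
      keeps every sampling time in [0,T], where alone the coordinates are known to be
      measurable.\<close>
    have "bernstein_path T n (\<lambda>k. F u (T * (real (min k n) / real n))) =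
        bernstein_path T n (\<lambda>k. F u (T * (real k / real n)))" for n
      unfolding bernstein_path_def by (intro arg_cong[where f="\<lambda>f. restrict f {0..T}"] ext sum.cong) auto
    then show ?thesis
      using continuous_map_path_tendsto[OF f bernstein_path_approx[OF T F[OF \<open>u \<in> space M\<close>]]] by simp
  qed
next
  fix n
  have "continuous_on UNIV (\<lambda>c. f (bernstein_path T n c))"
    unfolding continuous_on_sequentially o_def
  proof (intro allI ballI impI)
    fix x :: "nat \<Rightarrow> nat \<Rightarrow> real" and a assume "(\<forall>n. x n \<in> UNIV) \<and> x \<longlonglongrightarrow> a"
    then have "(\<lambda>i. x i k) \<longlonglongrightarrow> a k" for k
      using continuous_on_tendsto_compose[OF continuous_on_product_coordinates, of x a sequentially k]
      by simp
    then show "(\<lambda>i. f (bernstein_path T n (x i))) \<longlonglongrightarrow> f (bernstein_path T n a)"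
      by (intro continuous_map_path_tendsto[OF f] bernstein_path_tendsto[OF T])
  qed
  then have 1: "(\<lambda>c. f (bernstein_path T n c)) \<in> borel_measurable borel"
    by (rule borel_measurable_continuous_onI)
  have "T * (real (min k n) / real n) \<in> {0..T}" for k
  proof -
    have "real (min k n) / real n \<le> 1"
      by (cases "n = 0") (simp_all add: divide_le_eq_1)
    then show ?thesis
      using T by (simp add: mult_left_le del: times_divide_eq_right)
  qed
  then have "(\<lambda>u k. F u (T * (real (min k n) / real n))) \<in> borel_measurable M"
    by (intro measurable_coordinatewise_then_product meas)
  from measurable_compose[OF this 1]
  show "(\<lambda>u. f (bernstein_path T n (\<lambda>k. F u (T * (real (min k n) / real n))))) \<in> borel_measurable M" .
qed

text \<open>An open set is where the distance to its complement is positive, and that distance is a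
  continuous functional of the path; so measurable coordinates are enough.\<close>

lemma path_measurableI:
  assumes T: "0 < T" and F: "\<And>u. u \<in> space M \<Longrightarrow> F u \<in> \<Omega> T"
    and meas: "\<And>t. t \<in> {0..T} \<Longrightarrow> (\<lambda>u. F u t) \<in> borel_measurable M"
  shows "F \<in> measurable M (path_borel T)"
  unfolding path_borel_def
proof (rule measurable_measure_of)
  let ?X = "mtopology_of (path_metric T)"
  interpret Metric_space "\<Omega> T" "mdist (path_metric T)"
    by (rule Metric_space_mspace_mdist)
  fix U assume "U \<in> {U. openin ?X U}"
  then have U: "openin ?X U" "U \<subseteq> \<Omega> T"
    using openin_path_subset by auto
  show "F -` U \<inter> space M \<in> sets M"
  \<comment> \<open>For the whole space the complement is empty and the infimum defining the
    distance would be meaningless.\<close>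
  proof (cases "U = \<Omega> T")
    case True
    then have "F -` U \<inter> space M = space M" using F by auto
    then show ?thesis by simp
  next
    case False
    define g where "g x = (INF y\<in>\<Omega> T - U. mdist (path_metric T) x y)" for x
    have ne: "\<Omega> T - U \<noteq> {}" using False U by auto
    have bdd: "bdd_below ((\<lambda>y. mdist (path_metric T) x y) ` A)" for x A
      by (rule bdd_belowI[of _ 0]) auto
    have "g x \<le> g y + mdist (path_metric T) x y" if "x \<in> \<Omega> T" "y \<in> \<Omega> T" for x y
    proof -
      have "g x - mdist (path_metric T) x y \<le> g y"
        unfolding g_def
      proof (rule cINF_greatest[OF ne])
        fix z assume z: "z \<in> \<Omega> T - U"
        then have "(INF y\<in>\<Omega> T - U. mdist (path_metric T) x y) \<le> mdist (path_metric T) x z"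
          by (intro cINF_lower bdd)
        also have "\<dots> \<le> mdist (path_metric T) x y + mdist (path_metric T) y z"
          using that z by (intro triangle) auto
        finally show "(INF y\<in>\<Omega> T - U. mdist (path_metric T) x y) - mdist (path_metric T) x y
          \<le> mdist (path_metric T) y z" by simp
      qed
      then show ?thesis by simp
    qed
    note * = this
    have "\<bar>g x - g y\<bar> \<le> mdist (path_metric T) x y" if "x \<in> \<Omega> T" "y \<in> \<Omega> T" for x y
      using *[OF that] *[OF that(2,1)] commute[of x y] by linarith
    then have "Lipschitz_continuous_map (path_metric T) euclidean_metric g"
      unfolding Lipschitz_continuous_map_def
      by (intro conjI exI[of _ 1]) (auto simp: dist_real_def)
    then have "continuous_map ?X (mtopology_of euclidean_metric) g"
      by (rule Lipschitz_continuous_imp_continuous_map)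
    then have g: "continuous_map ?X euclideanreal g" by simp
    have "x \<in> U \<longleftrightarrow> g x > 0" if x: "x \<in> \<Omega> T" for x
    proof
      assume "x \<in> U"
      then obtain r where r: "r > 0" "mball x r \<subseteq> U"
        using U(1) unfolding mtopology_of_def openin_mtopology by blast
      have "r \<le> g x"
        unfolding g_def
      proof (rule cINF_greatest[OF ne])
        fix z assume "z \<in> \<Omega> T - U"
        then have "z \<notin> mball x r" "z \<in> \<Omega> T"
          using r(2) by blast+
        then show "r \<le> mdist (path_metric T) x z"
          using x by simp
      qed
      with r show "g x > 0" by simp
    next
      assume "g x > 0"
      show "x \<in> U"
      proof (rule ccontr)
        assume "x \<notin> U"
        then have "g x \<le> mdist (path_metric T) x x"
          unfolding g_def by (intro cINF_lower bdd) (use x in auto)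
        with \<open>g x > 0\<close> x show False by simp
      qed
    qed
    then have "F -` U \<inter> space M = {u \<in> space M. 0 < g (F u)}"
      using F by auto
    also have "\<dots> \<in> sets M"
      using continuous_path_functional_measurable[OF T F meas g]
      by (rule borel_measurable_less[OF borel_measurable_const])
    finally show ?thesis .
  qed
qed (use F openin_path_subset in auto)

subsection \<open>A Cantor code\<close>

text \<open>Digits 0 and 1 in base 3, as in the Cantor set. All digits after position n together
  weigh at most half of digit n, so distinct sequences have separated codes; in base 2 carries would
  destroy injectivity.\<close>

definition code :: "(nat \<Rightarrow> bool) \<Rightarrow> real" where
  "code b = (\<Sum>k. of_bool (b k) / 3 ^ k)"

lemma summable_code: "summable (\<lambda>k. of_bool (b k) / 3 ^ k :: real)"
  by (rule summable_comparison_test'[of "\<lambda>k. (1/3::real) ^ k" 0])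
    (auto simp: power_divide intro!: summable_geometric[of "1/3", unfolded power_divide power_one])

lemma code_nonneg: "0 \<le> code b"
  unfolding code_def by (intro suminf_nonneg summable_code) auto

lemma code_le: "code b \<le> 3 / 2"
proof -
  have "code b \<le> (\<Sum>k. (1/3::real) ^ k)"
    unfolding code_def by (intro suminf_le summable_code summable_geometric) (auto simp: power_divide)
  then show ?thesis by (simp add: suminf_geometric)
qed

lemma code_split: "code b = (\<Sum>k<n. of_bool (b k) / 3 ^ k) + code (\<lambda>k. b (k + n)) / 3 ^ n"
proof -
  have "code b = (\<Sum>k. of_bool (b (k + n)) / 3 ^ (k + n)) + (\<Sum>k<n. of_bool (b k) / 3 ^ k)"
    unfolding code_def by (rule suminf_split_initial_segment[OF summable_code])
  also have "(\<Sum>k. of_bool (b (k + n)) / 3 ^ (k + n) :: real) = code (\<lambda>k. b (k + n)) / 3 ^ n"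
    unfolding code_def
    by (subst suminf_divide[OF summable_code, symmetric]) (simp add: power_add)
  finally show ?thesis by simp
qed

text \<open>The bound is decided at the first index n where the sequences differ: that digit
  contributes \<open>1 / 3 ^ n\<close>, the tails cancel at most half of it, and n \<le> k.\<close>

lemma code_separation:
  assumes "b k \<noteq> b' k"
  shows "1 / (2 * 3 ^ k) \<le> \<bar>code b - code b'\<bar>"
proof -
  define n where "n = (LEAST k. b k \<noteq> b' k)"
  have n: "b n \<noteq> b' n" and eq: "\<And>i. i < n \<Longrightarrow> b i = b' i" and "n \<le> k"
    unfolding n_def
    by (rule LeastI[of "\<lambda>k. b k \<noteq> b' k", OF assms], drule not_less_Least, simp,
        rule Least_le[of "\<lambda>k. b k \<noteq> b' k", OF assms])
  have "code b - code b' =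
      (of_bool (b n) - of_bool (b' n)) / 3 ^ n
      + (code (\<lambda>k. b (k + Suc n)) - code (\<lambda>k. b' (k + Suc n))) / 3 ^ Suc n"
    using eq by (simp add: code_split[of b "Suc n"] code_split[of b' "Suc n"] diff_divide_distrib
        del: power_Suc add_Suc_right)
  also have "\<dots> = ((of_bool (b n) - of_bool (b' n))
      + (code (\<lambda>k. b (k + Suc n)) - code (\<lambda>k. b' (k + Suc n))) / 3) / 3 ^ n"
    by (simp add: add_divide_distrib)
  finally have "\<bar>code b - code b'\<bar> = \<bar>(of_bool (b n) - of_bool (b' n))
      + (code (\<lambda>k. b (k + Suc n)) - code (\<lambda>k. b' (k + Suc n))) / 3\<bar> / 3 ^ n"
    by simp
  moreover have "\<bar>(of_bool (b n) - of_bool (b' n) :: real)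
      + (code (\<lambda>k. b (k + Suc n)) - code (\<lambda>k. b' (k + Suc n))) / 3\<bar> \<ge> 1 / 2"
  proof -
    have *: "1 / 2 \<le> \<bar>(of_bool p - of_bool q) + (x - y) / 3\<bar>"
      if "p \<noteq> q" "0 \<le> x" "x \<le> 3 / 2" "0 \<le> y" "y \<le> 3 / 2" for p q and x y :: real
    proof (cases p)
      case True
      with that(1) have "(of_bool p - of_bool q) + (x - y) / 3 \<ge> 1 / 2"
        using that(2-5) by (simp add: field_simps)
      then show ?thesis by linarith
    next
      case False
      with that(1) have "(of_bool p - of_bool q) + (x - y) / 3 \<le> - (1 / 2)"
        using that(2-5) by (simp add: field_simps)
      then show ?thesis by linarith
    qed
    show ?thesis
      by (rule *[OF n code_nonneg code_le code_nonneg code_le])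
  qed
  ultimately have "(1 / 2) / 3 ^ n \<le> \<bar>code b - code b'\<bar>"
    by (metis divide_right_mono zero_le_power zero_le_numeral)
  moreover have "(1 / 2) / 3 ^ k \<le> (1 / 2) / (3 ^ n :: real)"
    using \<open>n \<le> k\<close> by (intro divide_left_mono power_increasing) auto
  ultimately show ?thesis by (simp add: divide_divide_eq_left)
qed

lemma code_limit:
  assumes "(\<lambda>n. code (b n)) \<longlonglongrightarrow> y"
  obtains b' where "y = code b'" "\<And>k. \<forall>\<^sub>F n in sequentially. b n k = b' k"
proof -
  have "\<exists>v. \<forall>\<^sub>F n in sequentially. b n k = v" for k
  proof -
    have "Cauchy (\<lambda>n. code (b n))"
      using assms by (rule LIMSEQ_imp_Cauchy)
    then obtain N where N: "\<And>m n. m \<ge> N \<Longrightarrow> n \<ge> N \<Longrightarrow> \<bar>code (b m) - code (b n)\<bar> < 1 / (2 * 3 ^ k)"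
      unfolding Cauchy_def dist_real_def by (meson divide_pos_pos zero_less_mult_iff zero_less_numeral zero_less_one zero_less_power)
    have "b n k = b N k" if "n \<ge> N" for n
      using code_separation[of "b n" k "b N"] N[OF that order_refl] by fastforce
    then show ?thesis
      unfolding eventually_sequentially by blast
  qed
  then obtain b' where b': "\<And>k. \<forall>\<^sub>F n in sequentially. b n k = b' k"
    by metis
  have "(\<lambda>n. code (b n)) \<longlonglongrightarrow> code b'"
  proof (rule LIMSEQ_I)
    fix e :: real assume "e > 0"
    \<comment> \<open>Codes lie between 0 and \<open>3 / 2\<close>, so after m equal digits they
      differ by at most \<open>(3 / 2) * (1/3) ^ m\<close>.\<close>
    then obtain m where m: "(1/3) ^ m < e / (3/2)"
      using real_arch_pow_inv[of "e / (3/2)" "1/3"] by auto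
    have "\<forall>\<^sub>F n in sequentially. \<forall>k\<in>{..<m}. b n k = b' k"
      using b' by (intro eventually_ball_finite) auto
    then have "\<forall>\<^sub>F n in sequentially. norm (code (b n) - code b') < e"
    proof eventually_elim
      case (elim n)
      then have "(\<Sum>k<m. of_bool (b n k) / 3 ^ k :: real) = (\<Sum>k<m. of_bool (b' k) / 3 ^ k)"
        by (intro sum.cong) auto
      then have "code (b n) - code b' = (code (\<lambda>k. b n (k + m)) - code (\<lambda>k. b' (k + m))) / 3 ^ m"
        unfolding code_split[of "b n" m] code_split[of b' m] by (simp add: diff_divide_distrib)
      moreover have "\<bar>code (\<lambda>k. b n (k + m)) - code (\<lambda>k. b' (k + m))\<bar> \<le> 3 / 2"
        using code_nonneg[of "\<lambda>k. b n (k + m)"] code_le[of "\<lambda>k. b n (k + m)"]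
          code_nonneg[of "\<lambda>k. b' (k + m)"] code_le[of "\<lambda>k. b' (k + m)"] by linarith
      ultimately have "\<bar>code (b n) - code b'\<bar> \<le> (3 / 2) * (1/3) ^ m"
        using divide_right_mono[of _ "3 / 2" "3 ^ m :: real"] by (simp add: power_divide)
      with m show ?case by simp
    qed
    then show "\<exists>no. \<forall>n\<ge>no. norm (code (b n) - code b') < e"
      by (simp add: eventually_sequentially)
  qed
  with assms have "y = code b'"
    by (rule LIMSEQ_unique)
  with b' show ?thesis
    by (rule that[rotated])
qed

text \<open>Reads digit k off a real number. As a set of reals it makes sense off the range of
  \<open>code\<close> too, and its closedness makes the digit a Borel function.\<close>

definition bit_set :: "nat \<Rightarrow> real set" where
  "bit_set k = {code b | b. b k}"

lemma code_in_bit_set_iff: "code b \<in> bit_set k \<longleftrightarrow> b k"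
proof
  assume "code b \<in> bit_set k"
  then obtain b' where "code b = code b'" "b' k"
    unfolding bit_set_def by auto
  then show "b k"
    using code_separation[of b k b'] by (cases "b k") (auto simp: not_le zero_less_power[THEN not_le[THEN iffD2]])
qed (auto simp: bit_set_def)

lemma closed_bit_set: "closed (bit_set k)"
  unfolding closed_sequential_limits
proof safe
  fix x l assume "\<forall>n. x n \<in> bit_set k" and lim: "x \<longlonglongrightarrow> l"
  then have "\<forall>n. \<exists>b. x n = code b \<and> b k"
    unfolding bit_set_def by auto
  then obtain b where b: "\<And>n. x n = code (b n)" "\<And>n. b n k"
    by metis
  have "(\<lambda>n. code (b n)) \<longlonglongrightarrow> l"
    using lim b(1) by (metis (no_types, lifting) ext)
  then obtain b' where "l = code b'" "\<forall>\<^sub>F n in sequentially. b n k = b' k"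
    using code_limit by metis
  then show "l \<in> bit_set k"
    using b(2) by (auto simp: bit_set_def eventually_sequentially)
qed

lemma bit_set_measurable [measurable]: "bit_set k \<in> sets borel"
  using closed_bit_set by (rule borel_closed)

lemma code_measurable [measurable]:
  assumes [measurable]: "\<And>k. Measurable.pred M (\<lambda>u. b u k)"
  shows "(\<lambda>u. code (b u)) \<in> borel_measurable M"
  unfolding code_def of_bool_def by measurable

subsection \<open>Coding paths by real numbers\<close>

text \<open>Clamping lets all of \<open>rat\<close> index a countable dense set of times in [0,T]
  without side conditions; the price is that the map is not injective.\<close>

definition rat_time :: "real \<Rightarrow> rat \<Rightarrow> real" where
  "rat_time T r = T * max 0 (min 1 (of_rat r))"

text \<open>A path is determined by its values at rational times, and each value by its Dedekind
  cut; \<open>from_nat\<close> enumerates the pairs of time and threshold.\<close>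

definition path_bit :: "real \<Rightarrow> path \<Rightarrow> nat \<Rightarrow> bool" where
  "path_bit T \<omega> k = (case from_nat k of (r, q) \<Rightarrow> \<omega> (rat_time T r) \<le> of_rat q)"

definition path_code :: "real \<Rightarrow> path \<Rightarrow> real" where
  "path_code T \<omega> = code (path_bit T \<omega>)"

text \<open>The Dedekind cut read back from the digits. The infimum is taken in the extended reals
  so that it exists for arbitrary y; infinite results become 0.\<close>

definition coded_value :: "rat \<Rightarrow> real \<Rightarrow> real" where
  "coded_value r y =
     real_of_ereal (INF q. if y \<in> bit_set (to_nat (r, q)) then ereal (of_rat q) else \<infinity>)"

definition decodable :: "real \<Rightarrow> real \<Rightarrow> bool" where
  "decodable T y \<longleftrightarrow> (\<exists>\<omega>\<in>\<Omega> T. \<forall>r. \<omega> (rat_time T r) = coded_value r y)"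

text \<open>Reals that are not decodable go to the zero path, so the decoder is a total map into
  path space. A decodable real need not be a value of \<open>path_code\<close>.\<close>

definition path_decode :: "real \<Rightarrow> real \<Rightarrow> path" where
  "path_decode T y =
     (if decodable T y then SOME \<omega>. \<omega> \<in> \<Omega> T \<and> (\<forall>r. \<omega> (rat_time T r) = coded_value r y)
      else restrict (\<lambda>_. 0) {0..T})"

lemma rat_time_in: "0 \<le> T \<Longrightarrow> rat_time T r \<in> {0..T}"
  unfolding rat_time_def by (auto intro: mult_left_le)

lemma rat_time_dense:
  assumes "0 < T" "t \<in> {0..T}"
  obtains r where "(\<lambda>n. rat_time T (r n)) \<longlonglongrightarrow> t"
proof -
  have "\<exists>q::rat. t / T < of_rat q \<and> of_rat q < t / T + 1 / Suc n" for n
    by (rule of_rat_dense) simp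
  then obtain r where r: "t / T < of_rat (r n)" "of_rat (r n) < t / T + 1 / Suc n" for n
    by metis
  have "(\<lambda>n. t / T + 1 / Suc n) \<longlonglongrightarrow> t / T + 0"
    by (intro tendsto_add tendsto_const LIMSEQ_Suc lim_1_over_n)
  then have "(\<lambda>n. of_rat (r n)) \<longlonglongrightarrow> t / T"
    by (intro tendsto_sandwich[of "\<lambda>_. t / T" "\<lambda>n. of_rat (r n)" sequentially "\<lambda>n. t / T + 1 / Suc n"])
      (auto intro!: always_eventually less_imp_le r simp del: of_nat_Suc)
  then have "(\<lambda>n. rat_time T (r n)) \<longlonglongrightarrow> T * max 0 (min 1 (t / T))"
    unfolding rat_time_def by (intro tendsto_intros)
  moreover have "T * max 0 (min 1 (t / T)) = t"
    using assms by (auto simp: max_def min_def)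
  ultimately show ?thesis
    using that by simp
qed

lemma path_eq_on_rat_times:
  assumes "0 < T" "\<omega> \<in> \<Omega> T" "\<omega>' \<in> \<Omega> T" "\<And>r. \<omega> (rat_time T r) = \<omega>' (rat_time T r)"
  shows "\<omega> = \<omega>'"
proof (rule extensionalityI[of _ "{0..T}"])
  fix t assume t: "t \<in> {0..T}"
  obtain r where r: "(\<lambda>n. rat_time T (r n)) \<longlonglongrightarrow> t"
    using rat_time_dense assms(1) t by blast
  have *: "(\<lambda>n. w (rat_time T (r n))) \<longlonglongrightarrow> w t" if "w \<in> \<Omega> T" for w
    using that r t rat_time_in[of T] assms(1)
    by (intro continuous_on_tendsto_compose[of "{0..T}" w]) (auto simp: path_space_iff)
  show "\<omega> t = \<omega>' t"
    using LIMSEQ_unique *[OF assms(2)] *[OF assms(3)] unfolding assms(4) by blast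
qed (use assms in \<open>auto simp: path_space_iff\<close>)

text \<open>The digit for the threshold q = v is left free, since the infimum does not see it. This
  slack is essential for limits, where exactly that digit may come out either way.\<close>

lemma coded_value_eqI:
  assumes "\<And>q. v < of_rat q \<Longrightarrow> y \<in> bit_set (to_nat (r, q))"
    and "\<And>q. of_rat q < v \<Longrightarrow> y \<notin> bit_set (to_nat (r, q))"
  shows "coded_value r y = v"
proof -
  have "(INF q. if y \<in> bit_set (to_nat (r, q)) then ereal (of_rat q) else \<infinity>) = ereal v"
    (is "(INF q. ?f q) = _")
  proof (rule antisym)
    show "(INF q. ?f q) \<le> ereal v"
    proof (rule dense_ge)
      fix x assume "ereal v < x"
      then obtain q :: rat where q: "ereal v < ereal (of_rat q)" "ereal (of_rat q) < x"
        using ereal_dense3[of "ereal v" x] by auto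
      have "(INF q. ?f q) \<le> ?f q"
        by (rule INF_lower) simp
      also have "\<dots> \<le> x"
        using q assms(1)[of q] by simp
      finally show "(INF q. ?f q) \<le> x" .
    qed
    show "ereal v \<le> (INF q. ?f q)"
      using assms(2) by (intro INF_greatest) (auto simp: not_less[symmetric])
  qed
  then show ?thesis
    by (simp add: coded_value_def)
qed

lemma path_code_in_bit_set_iff:
  "path_code T \<omega> \<in> bit_set (to_nat (r, q)) \<longleftrightarrow> \<omega> (rat_time T r) \<le> of_rat q"
  by (simp add: path_code_def code_in_bit_set_iff path_bit_def)

lemma coded_value_path_code: "coded_value r (path_code T \<omega>) = \<omega> (rat_time T r)"
  by (rule coded_value_eqI) (auto simp: path_code_in_bit_set_iff)

lemma path_decode_eqI:
  assumes "0 < T" "\<omega> \<in> \<Omega> T" "\<And>r. coded_value r y = \<omega> (rat_time T r)"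
  shows "path_decode T y = \<omega>"
proof -
  have d: "decodable T y"
    unfolding decodable_def using assms(2,3) by (intro bexI[of _ \<omega>]) auto
  show ?thesis
    unfolding path_decode_def if_P[OF d]
  proof (rule some_equality)
    fix w assume "w \<in> \<Omega> T \<and> (\<forall>r. w (rat_time T r) = coded_value r y)"
    then show "w = \<omega>"
      using assms by (intro path_eq_on_rat_times[of T]) auto
  qed (use assms in auto)
qed

lemma path_decode_code: "0 < T \<Longrightarrow> \<omega> \<in> \<Omega> T \<Longrightarrow> path_decode T (path_code T \<omega>) = \<omega>"
  by (rule path_decode_eqI) (auto simp: coded_value_path_code)

lemma path_decode:
  assumes "decodable T y"
  shows "path_decode T y \<in> \<Omega> T" "path_decode T y (rat_time T r) = coded_value r y"
proof -
  have "\<exists>\<omega>. \<omega> \<in> \<Omega> T \<and> (\<forall>r. \<omega> (rat_time T r) = coded_value r y)"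
    using assms unfolding decodable_def by blast
  from someI_ex[OF this]
  show "path_decode T y \<in> \<Omega> T" "path_decode T y (rat_time T r) = coded_value r y"
    unfolding path_decode_def if_P[OF assms] by blast+
qed

lemma path_decode_in: "path_decode T y \<in> \<Omega> T"
proof (cases "decodable T y")
  case False
  then show ?thesis
    unfolding path_decode_def by (simp add: restrict_in_path_space del: restrict_apply)
qed (rule path_decode)

text \<open>Every digit freezes along the whole sequence, while the values at rational times
  converge along the subsequence. For thresholds different from the limit value the two must agree,
  so y decodes to \<open>\<omega>\<close>, although y need not equal
  \<open>path_code T \<omega>\<close>.\<close>

lemma path_decode_limit:
  assumes T: "0 < T" and w: "(\<lambda>n. path_code T (w n)) \<longlonglongrightarrow> y"
    and s: "strict_mono s" and lim: "limitin (mtopology_of (path_metric T)) (\<lambda>n. w (s n)) \<omega> sequentially"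
  shows "path_decode T y = \<omega>"
proof (rule path_decode_eqI[OF T])
  show "\<omega> \<in> \<Omega> T"
    using limitin_topspace[OF lim] by simp
  fix r
  obtain b where b: "y = code b" "\<And>k. \<forall>\<^sub>F n in sequentially. path_bit T (w n) k = b k"
    using code_limit[of "\<lambda>n. path_bit T (w n)" y] w unfolding path_code_def by metis
  have val: "(\<lambda>n. w (s n) (rat_time T r)) \<longlonglongrightarrow> \<omega> (rat_time T r)"
    using T by (intro limitin_path_coordinate[OF _ lim] rat_time_in) auto
  have ev: "\<forall>\<^sub>F n in sequentially. (w (s n) (rat_time T r) \<le> of_rat q) = (y \<in> bit_set (to_nat (r, q)))" for q
    using eventually_subseq[OF s b(2)[of "to_nat (r, q)"]]
    by eventually_elim (simp add: b(1) code_in_bit_set_iff path_bit_def)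
  show "coded_value r y = \<omega> (rat_time T r)"
  proof (rule coded_value_eqI)
    fix q assume "\<omega> (rat_time T r) < of_rat q"
    from order_tendstoD(2)[OF val this] ev[of q]
    have "\<forall>\<^sub>F n in sequentially. y \<in> bit_set (to_nat (r, q))"
      by eventually_elim auto
    then show "y \<in> bit_set (to_nat (r, q))" by simp
  next
    fix q assume "of_rat q < \<omega> (rat_time T r)"
    from order_tendstoD(1)[OF val this] ev[of q]
    have "\<forall>\<^sub>F n in sequentially. y \<notin> bit_set (to_nat (r, q))"
      by eventually_elim auto
    then show "y \<notin> bit_set (to_nat (r, q))" by simp
  qed
qed

lemma path_code_measurable:
  assumes "0 \<le> T"
  shows "path_code T \<in> borel_measurable (path_borel T)"
proof -
  have "Measurable.pred (path_borel T) (\<lambda>\<omega>. path_bit T \<omega> k)" for k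
  proof -
    obtain r q where k: "from_nat k = (r :: rat, q :: rat)" by fastforce
    have [measurable]: "(\<lambda>\<omega>. \<omega> (rat_time T r)) \<in> borel_measurable (path_borel T)"
      using assms by (intro path_evaluation_measurable rat_time_in)
    show ?thesis
      unfolding path_bit_def k by simp
  qed
  then show ?thesis
    unfolding path_code_def[abs_def] by (rule code_measurable)
qed

lemma coded_value_measurable [measurable]: "coded_value r \<in> borel_measurable borel"
  unfolding coded_value_def[abs_def] by measurable

text \<open>Uniform continuity on the dense rational times replaces the existence of a path by
  countable quantifiers, hence by a Borel condition; the converse extends a uniformly continuous
  function to the closure.\<close>

lemma decodable_iff:
  assumes T: "0 < T"
  shows "decodable T y \<longleftrightarrow> (\<forall>m::nat. \<exists>k::nat. \<forall>r r'.
    \<bar>rat_time T r - rat_time T r'\<bar> < 1 / Suc k \<longrightarrow> \<bar>coded_value r y - coded_value r' y\<bar> < 1 / Suc m)"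
    (is "_ \<longleftrightarrow> ?uc")
proof
  assume "decodable T y"
  then obtain w where w: "w \<in> \<Omega> T" "\<And>r. w (rat_time T r) = coded_value r y"
    unfolding decodable_def by blast
  have "uniformly_continuous_on {0..T} w"
    using w(1) by (intro compact_uniformly_continuous) (auto simp: path_space_iff)
  then have uc: "\<exists>d>0. \<forall>x\<in>{0..T}. \<forall>x'\<in>{0..T}. dist x' x < d \<longrightarrow> dist (w x') (w x) < e" if "e > 0" for e
    using that unfolding uniformly_continuous_on_def by blast
  show ?uc
  proof
    fix m :: nat
    obtain d where d: "d > 0" "\<And>x x'. x \<in> {0..T} \<Longrightarrow> x' \<in> {0..T} \<Longrightarrow> dist x' x < d \<Longrightarrow> dist (w x') (w x) < 1 / Suc m"
      using uc[of "1 / Suc m"] by auto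
    obtain k :: nat where k: "1 / Suc k < d"
      using d(1) nat_approx_posE by blast
    have "\<bar>coded_value r y - coded_value r' y\<bar> < 1 / Suc m"
      if "\<bar>rat_time T r - rat_time T r'\<bar> < 1 / Suc k" for r r'
      using d(2)[OF rat_time_in rat_time_in, of r' r] that k T
      unfolding dist_real_def w(2) by linarith
    then show "\<exists>k::nat. \<forall>r r'. \<bar>rat_time T r - rat_time T r'\<bar> < 1 / Suc k \<longrightarrow>
        \<bar>coded_value r y - coded_value r' y\<bar> < 1 / Suc m"
      by blast
  qed
next
  assume uc: ?uc
  \<comment> \<open>Several rationals may give the same time after clamping; an arbitrary one is
    picked, and the oscillation condition at distance 0 shows that the choice does not
    matter.\<close>
  define f where "f s = coded_value (SOME r. rat_time T r = s) y" for s
  have pick: "rat_time T (SOME r'. rat_time T r' = rat_time T r) = rat_time T r" for r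
    by (rule someI[of "\<lambda>r'. rat_time T r' = rat_time T r" r]) simp
  have fv: "f (rat_time T r) = coded_value r y" for r
  proof (rule ccontr)
    assume "f (rat_time T r) \<noteq> coded_value r y"
    then obtain m :: nat where m: "1 / Suc m < \<bar>f (rat_time T r) - coded_value r y\<bar>"
      using nat_approx_posE[of "\<bar>f (rat_time T r) - coded_value r y\<bar>"] by auto
    moreover have "\<bar>f (rat_time T r) - coded_value r y\<bar> < 1 / Suc m"
      using uc[rule_format, of m] pick[of r] unfolding f_def by fastforce
    ultimately show False by simp
  qed
  have "uniformly_continuous_on (range (rat_time T)) f"
    unfolding uniformly_continuous_on_def
  proof (intro allI impI)
    fix e :: real assume "e > 0"
    then obtain m :: nat where m: "1 / Suc m < e"
      using nat_approx_posE by blast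
    obtain k :: nat where k: "\<And>r r'. \<bar>rat_time T r - rat_time T r'\<bar> < 1 / Suc k \<Longrightarrow>
        \<bar>coded_value r y - coded_value r' y\<bar> < 1 / Suc m"
      using uc by blast
    have "dist (f x') (f x) < e"
      if xx: "x \<in> range (rat_time T)" "x' \<in> range (rat_time T)" "dist x' x < 1 / Suc k" for x x'
    proof -
      obtain r r' where r: "x = rat_time T r" "x' = rat_time T r'"
        using xx by blast
      have "\<bar>coded_value r' y - coded_value r y\<bar> < 1 / Suc m"
        using k[of r' r] xx(3) unfolding r dist_real_def by simp
      then show ?thesis
        using m unfolding r fv dist_real_def by linarith
    qed
    then show "\<exists>d>0. \<forall>x\<in>range (rat_time T). \<forall>x'\<in>range (rat_time T). dist x' x < d \<longrightarrow> dist (f x') (f x) < e"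
      by (intro exI[of _ "1 / Suc k"]) auto
  qed
  then obtain g where g: "uniformly_continuous_on (closure (range (rat_time T))) g"
    "\<And>x. x \<in> range (rat_time T) \<Longrightarrow> f x = g x"
    using uniformly_continuous_on_extension_on_closure by metis
  have "{0..T} \<subseteq> closure (range (rat_time T))"
  proof
    fix t assume "t \<in> {0..T}"
    then obtain r where "(\<lambda>n. rat_time T (r n)) \<longlonglongrightarrow> t"
      using rat_time_dense T by blast
    then show "t \<in> closure (range (rat_time T))"
      unfolding closure_sequential by (intro exI[of _ "\<lambda>n. rat_time T (r n)"]) auto
  qed
  then have "continuous_on {0..T} g"
    using g(1) uniformly_continuous_imp_continuous continuous_on_subset by blast
  then have "restrict g {0..T} \<in> \<Omega> T"
    by (rule restrict_in_path_space)
  moreover have "restrict g {0..T} (rat_time T r) = coded_value r y" for r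
    using rat_time_in[of T r] T g(2)[of "rat_time T r"] fv[of r] by simp
  ultimately show "decodable T y"
    unfolding decodable_def by blast
qed

lemma decodable_measurable:
  assumes "0 < T"
  shows "Measurable.pred borel (decodable T)"
  unfolding decodable_iff[OF assms] by measurable

lemma path_decode_measurable:
  assumes T: "0 < T"
  shows "path_decode T \<in> measurable borel (path_borel T)"
proof (rule path_measurableI[OF T path_decode_in])
  fix t assume t: "t \<in> {0..T}"
  obtain r where r: "(\<lambda>n. rat_time T (r n)) \<longlonglongrightarrow> t"
    using rat_time_dense T t by blast
  note [measurable] = decodable_measurable[OF T]
  show "(\<lambda>y. path_decode T y t) \<in> borel_measurable borel"
  proof (rule borel_measurable_LIMSEQ_real)
    \<comment> \<open>The value 0 is that of the default path.\<close>
    show "(\<lambda>y. if decodable T y then coded_value (r n) y else 0) \<in> borel_measurable borel" for n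
      by measurable
    show "(\<lambda>n. if decodable T y then coded_value (r n) y else 0) \<longlonglongrightarrow> path_decode T y t" for y
    proof (cases "decodable T y")
      case True
      have "(\<lambda>n. path_decode T y (rat_time T (r n))) \<longlonglongrightarrow> path_decode T y t"
        using path_decode_in[of T y] r t rat_time_in[of T] T
        by (intro continuous_on_tendsto_compose[of "{0..T}" "path_decode T y"]) (auto simp: path_space_iff)
      then show ?thesis
        using True by (simp add: path_decode)
    next
      case False
      then show ?thesis
        using t by (simp add: path_decode_def)
    qed
  qed
qed

subsection \<open>Prokhorov's theorem for path space\<close>

text \<open>Only a sequence that meets \<open>K\<close> infinitely often matters: each of its subsequences in \<open>K\<close>
  has a limit point, and the code identifies all these limit points.\<close>

lemma decode_converges_on_compact:
  assumes T: "0 < T"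
    and cpt: "\<And>x :: nat \<Rightarrow> path. (\<And>n. x n \<in> K) \<Longrightarrow>
      \<exists>s \<omega>. strict_mono s \<and> limitin (mtopology_of (path_metric T)) (\<lambda>n. x (s n)) \<omega> sequentially"
    and w: "(\<lambda>n. path_code T (w n)) \<longlonglongrightarrow> y"
    and f: "continuous_map (mtopology_of (path_metric T)) euclideanreal f"
  shows "(\<lambda>n. indicat_real K (w n) * \<bar>f (w n) - f (path_decode T y)\<bar>) \<longlonglongrightarrow> 0"
proof (rule ccontr)
  let ?h = "\<lambda>n. indicat_real K (w n) * \<bar>f (w n) - f (path_decode T y)\<bar>"
  assume "\<not> ?h \<longlonglongrightarrow> 0"
  then obtain e where e: "e > 0" "\<And>N. \<exists>n\<ge>N. e \<le> \<bar>?h n\<bar>"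
    unfolding LIMSEQ_def dist_real_def by (auto simp: not_less)
  \<comment> \<open>The indices where convergence fails by e. There the indicator is nonzero, so
    these paths lie in K and have a convergent subsequence.\<close>
  define S where "S = {n. e \<le> \<bar>?h n\<bar>}"
  have inf: "infinite S"
    unfolding infinite_nat_iff_unbounded_le S_def using e(2) by auto
  have S: "w (enumerate S n) \<in> K" "e \<le> \<bar>f (w (enumerate S n)) - f (path_decode T y)\<bar>" for n
  proof -
    have "e \<le> \<bar>?h (enumerate S n)\<bar>"
      using enumerate_in_set[OF inf, of n] unfolding S_def by simp
    then show "w (enumerate S n) \<in> K" "e \<le> \<bar>f (w (enumerate S n)) - f (path_decode T y)\<bar>"
      using e(1) by (cases "w (enumerate S n) \<in> K"; simp)+
  qed
  obtain s \<omega> where s: "strict_mono s"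
    "limitin (mtopology_of (path_metric T)) (\<lambda>n. w (enumerate S (s n))) \<omega> sequentially"
    using cpt[of "\<lambda>n. w (enumerate S n)"] S(1) by blast
  have "strict_mono (\<lambda>n. enumerate S (s n))"
    using strict_mono_o[OF strict_mono_enumerate[OF inf] s(1)] by (simp add: o_def)
  then have "path_decode T y = \<omega>"
    by (rule path_decode_limit[OF T w]) (rule s(2))
  then have "(\<lambda>n. f (w (enumerate S (s n)))) \<longlonglongrightarrow> f (path_decode T y)"
    using continuous_map_path_tendsto[OF f s(2)] by simp
  then have "\<forall>\<^sub>F n in sequentially. \<bar>f (w (enumerate S (s n))) - f (path_decode T y)\<bar> < e"
    using e(1) unfolding tendsto_iff dist_real_def by blast
  then show False
    using S(2) by (auto simp: eventually_sequentially not_less[symmetric])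
qed

text \<open>Decoding inverts coding on paths, so both claims hold for the law of the codes, and they
  depend on \<open>Y\<close> only through its law. This transports a representation on the line back
  to path space.\<close>

lemma path_decode_random_code:
  assumes T: "0 < T" and P: "prob_space P" "sets P = sets (path_borel T)"
    and Y: "Y \<in> borel_measurable \<Theta>" "distr \<Theta> borel Y = distr P borel (path_code T)"
  shows "distr \<Theta> (path_borel T) (\<lambda>u. path_decode T (Y u)) = P"
    and "AE u in \<Theta>. path_code T (path_decode T (Y u)) = Y u"
proof -
  have sp: "space P = \<Omega> T"
    using sets_eq_imp_space_eq[OF P(2)] by simp
  note [measurable] = path_decode_measurable[OF T] Y(1) path_code_measurable[OF less_imp_le[OF T]]
  have [measurable]: "path_code T \<in> borel_measurable P"
    using path_code_measurable[of T] T by (simp add: measurable_cong_sets[OF P(2) refl])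
  have "distr \<Theta> (path_borel T) (\<lambda>u. path_decode T (Y u)) =
      distr (distr \<Theta> borel Y) (path_borel T) (path_decode T)"
    by (subst distr_distr) (auto simp: o_def)
  also have "\<dots> = distr P (path_borel T) (\<lambda>w. path_decode T (path_code T w))"
    unfolding Y(2) by (subst distr_distr) (auto simp: o_def)
  also have "\<dots> = distr P (path_borel T) (\<lambda>w. w)"
    by (rule distr_cong) (auto simp: sp path_decode_code T)
  also have "\<dots> = P"
    by (rule distr_id2) (simp add: P(2))
  finally show "distr \<Theta> (path_borel T) (\<lambda>u. path_decode T (Y u)) = P" .
  have "AE y in distr P borel (path_code T). path_code T (path_decode T y) = y"
    by (subst AE_distr_iff) (auto simp: sp path_decode_code T intro!: AE_I2)
  then have "AE y in distr \<Theta> borel Y. path_code T (path_decode T y) = y"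
    by (simp only: Y(2))
  then show "AE u in \<Theta>. path_code T (path_decode T (Y u)) = Y u"
    by (subst (asm) AE_distr_iff) auto
qed

text \<open>The codes of the paths have laws on a compact interval; Helly's selection theorem and
  Skorohod's theorem on the line give almost surely convergent codes, and these are decoded.\<close>

theorem path_prokhorov:
  fixes P :: "nat \<Rightarrow> path measure"
  assumes T: "0 < T" and P: "\<And>n. prob_space (P n)" "\<And>n. sets (P n) = sets (path_borel T)"
    and K: "\<And>m. K m \<in> sets (path_borel T)"
    and tight: "\<And>n m. measure (P n) (\<Omega> T - K m) \<le> 1 / Suc m"
    and cpt: "\<And>m (x :: nat \<Rightarrow> path). (\<And>n. x n \<in> K m) \<Longrightarrow>
      \<exists>s \<omega>. strict_mono s \<and> limitin (mtopology_of (path_metric T)) (\<lambda>n. x (s n)) \<omega> sequentially"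
  obtains r Q where "strict_mono r" "prob_space Q" "sets Q = sets (path_borel T)"
    "weak_convergence T (\<lambda>n. P (r n)) Q"
proof -
  have sp: "space (P n) = \<Omega> T" for n
    using sets_eq_imp_space_eq[OF P(2)] by simp
  have code_P [measurable]: "path_code T \<in> borel_measurable (P n)" for n
    using path_code_measurable[of T] T by (simp add: measurable_cong_sets[OF P(2) refl])
  define \<mu> where "\<mu> n = distr (P n) borel (path_code T)" for n
  have rd: "real_distribution (\<mu> n)" for n
    unfolding \<mu>_def by (intro prob_space.real_distribution_distr P code_P)
  \<comment> \<open>All codes lie in [0, 3/2], so their laws are tight whatever the laws of the
    paths; the sets \<open>K m\<close> serve to pass from codes back to paths.\<close>
  have "measure (\<mu> n) {-1<..2} = 1" for n
  proof -
    have "path_code T -` {-1<..2} \<inter> space (P n) = space (P n)"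
    proof -
      have "-1 < code b" "code b \<le> 2" for b
        using code_nonneg[of b] code_le[of b] by linarith+
      then show ?thesis
        by (auto simp: path_code_def)
    qed
    then show ?thesis
      unfolding \<mu>_def by (subst measure_distr) (auto simp: prob_space.prob_space[OF P(1)])
  qed
  then have "tight \<mu>"
    unfolding tight_def using rd by (intro conjI allI impI exI[of _ "-1"] exI[of _ 2]) auto
  then obtain r M where r: "strict_mono r" "real_distribution M" "weak_conv_m (\<mu> \<circ> id \<circ> r) M"
    using tight_imp_convergent_subsubsequence[of \<mu> id] strict_mono_id by metis
  have "\<exists>(\<Theta> :: real measure) (Y_seq :: nat \<Rightarrow> real \<Rightarrow> real) (Y :: real \<Rightarrow> real).
    prob_space \<Theta> \<and> (\<forall>n. Y_seq n \<in> measurable \<Theta> borel) \<and>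
    (\<forall>n. distr \<Theta> borel (Y_seq n) = (\<mu> \<circ> id \<circ> r) n) \<and> Y \<in> measurable \<Theta> lborel \<and>
    distr \<Theta> borel Y = M \<and> (\<forall>x \<in> space \<Theta>. (\<lambda>n. Y_seq n x) \<longlonglongrightarrow> Y x)"
    by (rule Skorohod) (use rd r in \<open>auto simp: o_def\<close>)
  then obtain \<Theta> :: "real measure" and Yn and Y :: "real \<Rightarrow> real" where *: "prob_space \<Theta> \<and>
    (\<forall>n. Yn n \<in> measurable \<Theta> borel) \<and> (\<forall>n. distr \<Theta> borel (Yn n) = (\<mu> \<circ> id \<circ> r) n) \<and>
    Y \<in> measurable \<Theta> lborel \<and> distr \<Theta> borel Y = M \<and> (\<forall>x \<in> space \<Theta>. (\<lambda>n. Yn n x) \<longlonglongrightarrow> Y x)"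
    by (elim exE)
  then have \<Theta>: "prob_space \<Theta>" and law: "\<And>n. distr \<Theta> borel (Yn n) = \<mu> (r n)"
    and lim: "\<And>u. u \<in> space \<Theta> \<Longrightarrow> (\<lambda>n. Yn n u) \<longlonglongrightarrow> Y u"
    by auto
  from * have Yn [measurable]: "Yn n \<in> borel_measurable \<Theta>" for n
    by blast
  from * have Y: "Y \<in> borel_measurable \<Theta>"
    by (simp add: measurable_lborel1)
  interpret \<Theta>: prob_space \<Theta> by (rule \<Theta>)
  define Z where "Z n u = path_decode T (Yn n u)" for n u
  define Z' where "Z' u = path_decode T (Y u)" for u
  have Z_meas [measurable]: "Z n \<in> measurable \<Theta> (path_borel T)" for n
    unfolding Z_def[abs_def] using path_decode_measurable[OF T] by measurable
  have Z'_meas [measurable]: "Z' \<in> measurable \<Theta> (path_borel T)"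
    unfolding Z'_def[abs_def] using path_decode_measurable[OF T] Y by measurable
  have law_Z: "distr \<Theta> (path_borel T) (Z n) = P (r n)"
    and AE_Z: "AE u in \<Theta>. path_code T (Z n u) = Yn n u" for n
    using path_decode_random_code[OF T P Yn law[unfolded \<mu>_def]] unfolding Z_def[abs_def] by auto
  \<comment> \<open>The limit law is that of the decoded limit code. The code of \<open>Z'\<close>
    need not be \<open>Y\<close>: borderline digits may differ.\<close>
  define Q where "Q = distr \<Theta> (path_borel T) Z'"
  have "weak_convergence T (\<lambda>n. P (r n)) Q"
    unfolding weak_convergence_def
  proof (intro allI impI)
    fix f assume f: "continuous_map (mtopology_of (path_metric T)) euclideanreal f \<and> bounded (f ` \<Omega> T)"
    then obtain C where C: "\<And>\<omega>. \<omega> \<in> \<Omega> T \<Longrightarrow> \<bar>f \<omega>\<bar> \<le> C"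
      unfolding bounded_iff by auto
    have "0 \<le> C"
      using C[OF path_decode_in] abs_ge_zero order_trans by blast
    have f_meas [measurable]: "f \<in> borel_measurable (path_borel T)"
      using f path_continuous_measurable by blast
    have CZ: "\<bar>f (Z n u)\<bar> \<le> C" "\<bar>f (Z' u)\<bar> \<le> C" for n u
      unfolding Z_def Z'_def by (intro C path_decode_in)+
    have int: "integrable \<Theta> (\<lambda>u. f (Z n u))" "integrable \<Theta> (\<lambda>u. f (Z' u))" for n
      using CZ by (auto intro!: \<Theta>.integrable_const_bound[of _ C] AE_I2)
    have eq: "integral\<^sup>L (P (r n)) f = (\<integral>u. f (Z n u) \<partial>\<Theta>)" for n
      unfolding law_Z[symmetric] by (subst integral_distr) auto
    have eq': "integral\<^sup>L Q f = (\<integral>u. f (Z' u) \<partial>\<Theta>)"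
      unfolding Q_def by (subst integral_distr) auto
    show "(\<lambda>n. integral\<^sup>L (P (r n)) f) \<longlonglongrightarrow> integral\<^sup>L Q f"
      unfolding eq eq'
    proof (rule LIMSEQ_I)
      fix e :: real assume "e > 0"
      \<comment> \<open>Off \<open>K m\<close> the integrands differ by at most
        \<open>2 * C\<close>, with probability at most \<open>1 / Suc m\<close>; this m keeps that
        share below e / 2.\<close>
      obtain m :: nat where m: "2 * C * (1 / Suc m) < e / 2"
      proof -
        have "(\<lambda>m. 2 * C * (1 / Suc m)) \<longlonglongrightarrow> 2 * C * 0"
          by (intro tendsto_mult tendsto_const LIMSEQ_Suc lim_1_over_n)
        then have "\<forall>\<^sub>F m in sequentially. 2 * C * (1 / Suc m) < e / 2"
          using \<open>e > 0\<close> by (intro order_tendstoD(2)) auto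
        then show thesis
          using that by (auto simp: eventually_sequentially)
      qed
      note [measurable] = K[of m]
      define h where "h n u = indicat_real (K m) (Z n u) * \<bar>f (Z n u) - f (Z' u)\<bar>" for n u
      have h_meas [measurable]: "h n \<in> borel_measurable \<Theta>" for n
        unfolding h_def[abs_def] by measurable
      have h_bound: "\<bar>h n u\<bar> \<le> 2 * C" for n u
        using CZ(1)[of n u] CZ(2)[of u] unfolding h_def by (auto simp: indicator_def)
      have h_int: "integrable \<Theta> (h n)" for n
        using h_bound by (auto intro!: \<Theta>.integrable_const_bound[of _ "2 * C"] AE_I2)
      \<comment> \<open>Dominated convergence on \<open>K m\<close>: the deterministic statement
        applies at almost every u, namely where every \<open>Yn n u\<close> is the code of
        \<open>Z n u\<close>.\<close>
      have "(\<lambda>n. \<integral>u. h n u \<partial>\<Theta>) \<longlonglongrightarrow> (\<integral>u. 0 \<partial>\<Theta>)"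
      proof (rule integral_dominated_convergence[where w="\<lambda>_. 2 * C"])
        have "AE u in \<Theta>. \<forall>n. path_code T (Z n u) = Yn n u"
          using AE_Z by (simp add: AE_all_countable)
        with AE_space show "AE u in \<Theta>. (\<lambda>n. h n u) \<longlonglongrightarrow> 0"
        proof eventually_elim
          case (elim u)
          have "(\<lambda>n. path_code T (Z n u)) \<longlonglongrightarrow> Y u"
            using lim elim by simp
          then show ?case
            unfolding h_def Z'_def
            by (intro decode_converges_on_compact[OF T] cpt conjunct1[OF f])
        qed
      qed (use h_bound in auto)
      then have "\<forall>\<^sub>F n in sequentially. (\<integral>u. h n u \<partial>\<Theta>) < e / 2"
        using \<open>e > 0\<close> by (intro order_tendstoD(2)) auto
      then have "\<forall>\<^sub>F n in sequentially. norm ((\<integral>u. f (Z n u) \<partial>\<Theta>) - (\<integral>u. f (Z' u) \<partial>\<Theta>)) < e"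
      proof eventually_elim
        case (elim n)
        let ?B = "Z n -` (\<Omega> T - K m) \<inter> space \<Theta>"
        have KB: "\<Omega> T - K m \<in> sets (path_borel T)"
          using sets.compl_sets[OF K[of m]] by simp
        have B: "?B \<in> sets \<Theta>"
          by (rule measurable_sets[OF Z_meas KB])
        have B_int: "integrable \<Theta> (\<lambda>u. 2 * C * indicat_real ?B u)"
          by (intro integrable_mult_right integrable_real_indicator B)
            (simp add: \<Theta>.emeasure_finite less_top[symmetric])
        have prob: "measure \<Theta> ?B \<le> 1 / Suc m"
          using tight[of "r n" m] unfolding law_Z[symmetric] by (simp add: measure_distr KB)
        have "\<bar>(\<integral>u. f (Z n u) \<partial>\<Theta>) - (\<integral>u. f (Z' u) \<partial>\<Theta>)\<bar> = \<bar>\<integral>u. f (Z n u) - f (Z' u) \<partial>\<Theta>\<bar>"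
          using int by simp
        also have "\<dots> \<le> (\<integral>u. \<bar>f (Z n u) - f (Z' u)\<bar> \<partial>\<Theta>)"
          by (rule integral_abs_bound)
        also have "\<dots> \<le> (\<integral>u. h n u + 2 * C * indicat_real ?B u \<partial>\<Theta>)"
        proof (rule integral_mono)
          fix u assume "u \<in> space \<Theta>"
          then show "\<bar>f (Z n u) - f (Z' u)\<bar> \<le> h n u + 2 * C * indicat_real ?B u"
            using CZ(1)[of n u] CZ(2)[of u] path_decode_in[of T "Yn n u"]
            unfolding h_def by (auto simp: indicator_def Z_def)
        qed (use int h_int B_int in \<open>auto simp del: integrable_mult_right_iff\<close>)
        also have "\<dots> = (\<integral>u. h n u \<partial>\<Theta>) + 2 * C * measure \<Theta> ?B"
          by (subst Bochner_Integration.integral_add[OF h_int B_int]) (use B in simp)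
        also have "\<dots> \<le> (\<integral>u. h n u \<partial>\<Theta>) + 2 * C * (1 / Suc m)"
          using prob \<open>0 \<le> C\<close> by (intro add_left_mono mult_left_mono) auto
        also have "\<dots> < e"
          using elim m by simp
        finally show ?case by simp
      qed
      then show "\<exists>no. \<forall>n\<ge>no. norm ((\<integral>u. f (Z n u) \<partial>\<Theta>) - (\<integral>u. f (Z' u) \<partial>\<Theta>)) < e"
        by (simp add: eventually_sequentially)
    qed
  qed
  moreover have "prob_space Q"
    unfolding Q_def by (rule \<Theta>.prob_space_distr) measurable
  ultimately show ?thesis
    using that[of r Q] r(1) by (simp add: Q_def)
qed

subsection \<open>Kolmogorov's tightness criterion\<close>

text \<open>Chaining along left dyadic neighbours: going from level k down to a point costs a times
  the sum of \<open>(9 / 10) ^ j\<close> over j > k, which is \<open>9 * (9 / 10) ^ k\<close>. Two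
  such tails and one step at level k give the constant 19.\<close>

lemma dyadic_chaining:
  fixes g :: "real \<Rightarrow> real"
  assumes cont: "continuous_on {0..1} g" and a: "0 \<le> a"
    and step: "\<And>k i. i < 2 ^ k \<Longrightarrow> \<bar>g (Suc i / 2 ^ k) - g (i / 2 ^ k)\<bar> \<le> a * (9 / 10) ^ k"
    and st: "s \<in> {0..1}" "t \<in> {0..1}" "\<bar>s - t\<bar> \<le> 1 / 2 ^ k"
  shows "\<bar>g s - g t\<bar> \<le> 19 * a * (9 / 10) ^ k"
proof -
  define n where "n k t = nat \<lfloor>t * 2 ^ k\<rfloor>" for k and t :: real
  have n: "real (n k t) \<le> t * 2 ^ k" "t * 2 ^ k < real (n k t) + 1" if "t \<in> {0..1}" for k t
    using that unfolding n_def by (auto simp: of_nat_nat)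
  have n_in: "real (n k t) / 2 ^ k \<in> {0..1}" if "t \<in> {0..1}" for k t
  proof -
    have "t * 2 ^ k \<le> 1 * 2 ^ k"
      using that by (intro mult_right_mono) auto
    with n(1)[OF that, of k] have "real (n k t) \<le> 2 ^ k" by linarith
    then show ?thesis by (simp add: divide_le_eq)
  qed
  \<comment> \<open>Points at distance at most \<open>1 / 2 ^ k\<close> have equal or adjacent left
    neighbours at level k.\<close>
  have adj: "\<bar>g (real (n k s) / 2 ^ k) - g (real (n k t) / 2 ^ k)\<bar> \<le> a * (9 / 10) ^ k"
    if "s \<in> {0..1}" "t \<in> {0..1}" "s \<le> t" "t \<le> s + 1 / 2 ^ k" for k s t
  proof -
    have "t * 2 ^ k \<le> (s + 1 / 2 ^ k) * 2 ^ k" "s * 2 ^ k \<le> t * 2 ^ k"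
      using that by (intro mult_right_mono; simp)+
    moreover have "(s + 1 / 2 ^ k) * 2 ^ k = s * 2 ^ k + 1"
      by (simp add: distrib_right)
    ultimately have "real (n k t) < real (n k s) + 2" "real (n k s) < real (n k t) + 1"
      using n[OF that(1), of k] n[OF that(2), of k] by linarith+
    then consider "n k t = n k s" | "n k t = Suc (n k s)"
      by linarith
    then show ?thesis
    proof cases
      case 1
      then show ?thesis using a by simp
    next
      case 2
      have "real (n k t) \<le> 2 ^ k"
        using n_in[OF that(2), of k] by (simp add: divide_le_eq)
      then have "n k s < 2 ^ k"
        unfolding 2 by (metis Suc_le_eq of_nat_le_iff of_nat_numeral of_nat_power)
      from step[OF this] show ?thesis
        unfolding 2 by (simp add: abs_minus_commute)
    qed
  qed
  have next_level: "\<bar>g (real (n (Suc k) t) / 2 ^ Suc k) - g (real (n k t) / 2 ^ k)\<bar> \<le> a * (9 / 10) ^ Suc k"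
    if t: "t \<in> {0..1}" for k t
  proof -
    have "real (n (Suc k) t) < 2 * real (n k t) + 2" "2 * real (n k t) < real (n (Suc k) t) + 1"
      using n[OF t, of k] n[OF t, of "Suc k"] by simp_all
    then consider "n (Suc k) t = 2 * n k t" | "n (Suc k) t = Suc (2 * n k t)"
      by linarith
    then show ?thesis
    proof cases
      case 1
      then show ?thesis using a by simp
    next
      case 2
      have "real (n (Suc k) t) \<le> 2 ^ Suc k"
        using n_in[OF t, of "Suc k"] by (simp add: divide_le_eq)
      then have "2 * n k t < 2 ^ Suc k"
        unfolding 2 by (metis Suc_le_eq of_nat_le_iff of_nat_numeral of_nat_power)
      from step[OF this] show ?thesis
        unfolding 2 by simp
    qed
  qed
  have tail: "\<bar>g t - g (real (n k t) / 2 ^ k)\<bar> \<le> 9 * a * (9 / 10) ^ k" if t: "t \<in> {0..1}" for k t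
  proof (rule LIMSEQ_le_const2)
    have "\<bar>real (n (k + j) t) / 2 ^ (k + j) - t\<bar> \<le> (1 / 2) ^ j" for j
    proof -
      have "\<bar>real (n (k + j) t) / 2 ^ (k + j) - t\<bar> = \<bar>real (n (k + j) t) - t * 2 ^ (k + j)\<bar> / 2 ^ (k + j)"
        by (simp add: field_simps)
      also have "\<dots> \<le> 1 / 2 ^ (k + j)"
        using n[OF t, of "k + j"] by (intro divide_right_mono) auto
      also have "\<dots> \<le> 1 / 2 ^ j"
        by (intro divide_left_mono power_increasing) auto
      finally show ?thesis by (simp add: power_divide)
    qed
    then have "(\<lambda>j. real (n (k + j) t) / 2 ^ (k + j) - t) \<longlonglongrightarrow> 0"
      by (intro Lim_null_comparison[OF always_eventually LIMSEQ_power_zero[of "1 / 2 :: real"]]) auto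
    then have "(\<lambda>j. g (real (n (k + j) t) / 2 ^ (k + j))) \<longlonglongrightarrow> g t"
      using t n_in by (intro continuous_on_tendsto_compose[OF cont]) (auto simp: LIM_zero_iff)
    then show "(\<lambda>j. \<bar>g (real (n (k + j) t) / 2 ^ (k + j)) - g (real (n k t) / 2 ^ k)\<bar>)
        \<longlonglongrightarrow> \<bar>g t - g (real (n k t) / 2 ^ k)\<bar>"
      by (intro tendsto_intros)
    \<comment> \<open>The factor \<open>1 - (9 / 10) ^ j\<close> is the exact partial geometric sum,
      which lets the induction close.\<close>
    have "\<bar>g (real (n (k + j) t) / 2 ^ (k + j)) - g (real (n k t) / 2 ^ k)\<bar>
        \<le> 9 * a * (9 / 10) ^ k * (1 - (9 / 10) ^ j)" for j
    proof (induction j)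
      case (Suc j)
      have "a * (9 / 10) ^ Suc (k + j) + 9 * a * (9 / 10) ^ k * (1 - (9 / 10) ^ j)
          = 9 * a * (9 / 10) ^ k * (1 - (9 / 10) ^ Suc j)"
        by (simp add: power_add algebra_simps)
      then show ?case
        using Suc next_level[OF t, of "k + j"] unfolding add_Suc_right by linarith
    qed simp
    moreover have "9 * a * (9 / 10) ^ k * (1 - (9 / 10) ^ j) \<le> 9 * a * (9 / 10) ^ k" for j
      using a by (intro mult_left_le) auto
    ultimately show "\<exists>N. \<forall>j\<ge>N. \<bar>g (real (n (k + j) t) / 2 ^ (k + j)) - g (real (n k t) / 2 ^ k)\<bar>
        \<le> 9 * a * (9 / 10) ^ k"
      using order_trans by blast
  qed
  have mid: "\<bar>g (real (n k s) / 2 ^ k) - g (real (n k t) / 2 ^ k)\<bar> \<le> a * (9 / 10) ^ k"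
  proof (cases "s \<le> t")
    case True
    then show ?thesis
      using adj[OF st(1,2), of k] st(3) by simp
  next
    case False
    then show ?thesis
      using adj[OF st(2,1), of k] st(3) by (simp add: abs_minus_commute)
  qed
  show ?thesis
    using tail[OF st(1), of k] tail[OF st(2), of k] mid by linarith
qed

text \<open>The ratio \<open>r = 9 / 10\<close> satisfies \<open>1 / 2 < r ^ 4 < 1\<close>: the union bound over the \<open>2 ^ k\<close> steps of
  level \<open>k\<close> is then of order \<open>1 / (2 * r ^ 4) ^ k\<close>.\<close>

definition kolmogorov_set :: "real \<Rightarrow> real \<Rightarrow> path set" where
  "kolmogorov_set T a = {\<omega> \<in> \<Omega> T. \<omega> 0 = 0 \<and>
     (\<forall>k i. i < 2 ^ k \<longrightarrow> \<bar>\<omega> (T * (Suc i / 2 ^ k)) - \<omega> (T * (i / 2 ^ k))\<bar> \<le> a * (9 / 10) ^ k)}"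

lemma kolmogorov_set_modulus:
  assumes T: "0 < T" and a: "0 \<le> a" and w: "\<omega> \<in> kolmogorov_set T a"
    and st: "s \<in> {0..T}" "t \<in> {0..T}" "\<bar>s - t\<bar> \<le> T / 2 ^ k"
  shows "\<bar>\<omega> s - \<omega> t\<bar> \<le> 19 * a * (9 / 10) ^ k"
proof -
  have "\<bar>\<omega> (T * (s / T)) - \<omega> (T * (t / T))\<bar> \<le> 19 * a * (9 / 10) ^ k"
  proof (rule dyadic_chaining[where g="\<lambda>x. \<omega> (T * x)"])
    show "continuous_on {0..1} (\<lambda>x. \<omega> (T * x))"
      by (rule continuous_on_compose2[of "{0..T}" \<omega>])
        (use w T in \<open>auto simp: kolmogorov_set_def path_space_iff mult_left_le
          intro: continuous_on_mult_left continuous_on_id\<close>)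
    have "\<bar>s / T - t / T\<bar> = \<bar>s - t\<bar> / T"
      using T by (simp add: diff_divide_distrib[symmetric])
    also have "\<dots> \<le> (T / 2 ^ k) / T"
      using T st(3) by (intro divide_right_mono) auto
    finally show "\<bar>s / T - t / T\<bar> \<le> 1 / 2 ^ k"
      using T by simp
  qed (use w a T st in \<open>auto simp: kolmogorov_set_def\<close>)
  then show ?thesis using T by simp
qed

text \<open>Arzela-Ascoli: the modulus at k = 0 together with the start at 0 gives the uniform bound
  \<open>19 * a\<close>, the modulus at large k the equicontinuity. The limit is asked to be a path,
  not a member of the set.\<close>

lemma kolmogorov_set_compact:
  assumes T: "0 < T" and a: "0 \<le> a" and x: "\<And>n :: nat. x n \<in> kolmogorov_set T a"
  shows "\<exists>s \<omega>. strict_mono s \<and> limitin (mtopology_of (path_metric T)) (\<lambda>n. x (s n)) \<omega> sequentially"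
proof -
  have bound: "norm (x n t) \<le> 19 * a" if "t \<in> {0..T}" for n t
  proof -
    have "\<bar>x n t - x n 0\<bar> \<le> 19 * a * (9 / 10) ^ 0"
      by (rule kolmogorov_set_modulus[OF T a x]) (use that T in auto)
    moreover have "x n 0 = 0"
      using x[of n] by (simp add: kolmogorov_set_def)
    ultimately show ?thesis by simp
  qed
  have equi: "\<exists>d>0. \<forall>n t'. t' \<in> {0..T} \<and> norm (t - t') < d \<longrightarrow> norm (x n t - x n t') < e"
    if "t \<in> {0..T}" "0 < e" for t e
  proof -
    have "(\<lambda>k. 19 * a * (9 / 10) ^ k) \<longlonglongrightarrow> 19 * a * 0"
      by (intro tendsto_mult tendsto_const LIMSEQ_power_zero) simp
    then have "\<forall>\<^sub>F k in sequentially. 19 * a * (9 / 10) ^ k < e"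
      using \<open>0 < e\<close> by (intro order_tendstoD(2)) auto
    then obtain k where k: "19 * a * (9 / 10) ^ k < e"
      by (auto simp: eventually_sequentially)
    have "norm (x n t - x n t') < e" if t': "t' \<in> {0..T}" "norm (t - t') < T / 2 ^ k" for n t'
      using kolmogorov_set_modulus[OF T a x[of n] \<open>t \<in> {0..T}\<close> t'(1), of k] t'(2) k by simp
    then show ?thesis
      using T by (intro exI[of _ "T / 2 ^ k"]) auto
  qed
  obtain g s where g: "continuous_on {0..T} g" "strict_mono (s :: nat \<Rightarrow> nat)"
    "\<And>e. 0 < e \<Longrightarrow> \<exists>N. \<forall>n t. n \<ge> N \<and> t \<in> {0..T} \<longrightarrow> norm (x (s n) t - g t) < e"
    supply * = that
  proof (rule Arzela_Ascoli[of "{0..T}" x "19 * a"])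
    show "norm (x n t) \<le> 19 * a" if "t \<in> {0..T}" for n t
      using that by (rule bound)
    show "\<exists>d>0. \<forall>n t'. t' \<in> {0..T} \<and> norm (t - t') < d \<longrightarrow> norm (x n t - x n t') < e"
      if "t \<in> {0..T}" "0 < e" for t e
      using that by (rule equi)
    show thesis if "continuous_on {0..T} h" "strict_mono (k :: nat \<Rightarrow> nat)"
      "\<And>e. 0 < e \<Longrightarrow> \<exists>N. \<forall>n t. N \<le> n \<and> t \<in> {0..T} \<longrightarrow> norm (x (k n) t - h t) < e" for h k
      by (rule *[of h k]) (use that in auto)
  qed simp
  have "limitin (mtopology_of (path_metric T)) (\<lambda>n. x (s n)) (restrict g {0..T}) sequentially"
  proof (rule limitin_pathI)
    show "x (s n) \<in> \<Omega> T" for n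
      using x[of "s n"] by (simp add: kolmogorov_set_def)
    fix e :: real assume "e > 0"
    then obtain N where "\<And>n t. n \<ge> N \<Longrightarrow> t \<in> {0..T} \<Longrightarrow> norm (x (s n) t - g t) < e"
      using g(3) by blast
    then show "\<forall>\<^sub>F n in sequentially. \<forall>t\<in>{0..T}. \<bar>x (s n) t - restrict g {0..T} t\<bar> \<le> e"
      unfolding eventually_sequentially by (intro exI[of _ N]) (auto intro: less_imp_le)
  qed (use T restrict_in_path_space[OF g(1)] in auto)
  with g(2) show ?thesis by blast
qed

definition kolmogorov_jump :: "real \<Rightarrow> real \<Rightarrow> nat \<Rightarrow> nat \<Rightarrow> path set" where
  "kolmogorov_jump T a k i =
     {\<omega> \<in> \<Omega> T. a * (9 / 10) ^ k < \<bar>\<omega> (T * (Suc i / 2 ^ k)) - \<omega> (T * (i / 2 ^ k))\<bar>}"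

lemma dyadic_time_in:
  assumes "0 < T" "i \<le> 2 ^ k"
  shows "T * (real i / 2 ^ k) \<in> {0..T}"
proof -
  have "real i \<le> 2 ^ k"
    using assms(2) by (metis of_nat_le_iff of_nat_numeral of_nat_power)
  then have "real i / 2 ^ k \<le> 1"
    by (simp add: divide_le_eq)
  then show ?thesis
    using assms(1) by (simp add: mult_left_le del: times_divide_eq_right)
qed

lemma kolmogorov_jump_measurable:
  assumes "0 < T" "i < 2 ^ k"
  shows "kolmogorov_jump T a k i \<in> sets (path_borel T)"
proof -
  have [measurable]: "(\<lambda>\<omega>. \<omega> (T * (real j / 2 ^ k))) \<in> borel_measurable (path_borel T)"
    if "j \<in> {i, Suc i}" for j
    using assms that by (intro path_evaluation_measurable dyadic_time_in) auto
  have "{\<omega> \<in> space (path_borel T). a * (9 / 10) ^ k <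
      \<bar>\<omega> (T * (real (Suc i) / 2 ^ k)) - \<omega> (T * (real i / 2 ^ k))\<bar>} \<in> sets (path_borel T)"
    by measurable
  then show ?thesis
    by (simp add: kolmogorov_jump_def)
qed

lemma compl_kolmogorov_set:
  "\<Omega> T - kolmogorov_set T a =
     {\<omega> \<in> \<Omega> T. \<omega> 0 \<noteq> 0} \<union> (\<Union>k. \<Union>i\<in>{..<2 ^ k}. kolmogorov_jump T a k i)"
  unfolding kolmogorov_set_def kolmogorov_jump_def not_less[symmetric] by blast

lemma path_start_measurable:
  assumes "0 < T"
  shows "{\<omega> \<in> \<Omega> T. \<omega> 0 \<noteq> 0} \<in> sets (path_borel T)"
proof -
  have [measurable]: "(\<lambda>\<omega>. \<omega> 0) \<in> borel_measurable (path_borel T)"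
    using assms by (intro path_evaluation_measurable) auto
  have "{\<omega> \<in> space (path_borel T). \<omega> 0 \<noteq> 0} \<in> sets (path_borel T)"
    using assms by measurable
  then show ?thesis by simp
qed

lemma kolmogorov_set_measurable:
  assumes "0 < T"
  shows "kolmogorov_set T a \<in> sets (path_borel T)"
proof -
  have "\<Omega> T - kolmogorov_set T a \<in> sets (path_borel T)"
    unfolding compl_kolmogorov_set
    by (intro sets.Un path_start_measurable assms sets.countable_UN sets.finite_UN image_subsetI)
      (auto intro: kolmogorov_jump_measurable assms)
  from sets.compl_sets[OF this] have "\<Omega> T - (\<Omega> T - kolmogorov_set T a) \<in> sets (path_borel T)"
    by simp
  moreover have "\<Omega> T - (\<Omega> T - kolmogorov_set T a) = kolmogorov_set T a"
    unfolding kolmogorov_set_def by auto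
  ultimately show ?thesis by simp
qed

text \<open>Union bound over the dyadic jumps. The square of the time step \<open>T / 2 ^ k\<close>
  beats the number \<open>2 ^ k\<close> of steps by enough to absorb the shrinking thresholds; the
  levels form a geometric series of ratio 1 / (2 * 0.6561), that is 10000 / 13122.\<close>

lemma kolmogorov_set_prob:
  assumes T: "0 < T" and P: "prob_space P" "sets P = sets (path_borel T)"
    and a: "0 < a" and c: "0 \<le> c" and start: "AE \<omega> in P. \<omega> 0 = 0"
    and incr: "\<And>s t l. 0 \<le> s \<Longrightarrow> s < t \<Longrightarrow> t \<le> T \<Longrightarrow> 0 < l \<Longrightarrow>
      measure P {\<omega> \<in> \<Omega> T. l < \<bar>\<omega> t - \<omega> s\<bar>} \<le> c * (t - s)\<^sup>2 / l ^ 4"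
  shows "measure P (\<Omega> T - kolmogorov_set T a) \<le> 5 * c * T\<^sup>2 / a ^ 4"
proof -
  interpret prob_space P by (rule P)
  have sp: "space P = \<Omega> T"
    using sets_eq_imp_space_eq[OF P(2)] by simp
  define B where "B k = (\<Union>i\<in>{..<2 ^ k}. kolmogorov_jump T a k i)" for k
  have jump: "kolmogorov_jump T a k i \<in> sets P" if "i < 2 ^ k" for k i
    using kolmogorov_jump_measurable[OF T that] P(2) by simp
  have B_sets: "B k \<in> sets P" for k
    unfolding B_def by (intro sets.finite_UN) (auto intro: jump)
  have B_le: "measure P (B k) \<le> c * T\<^sup>2 / a ^ 4 * (10000 / 13122) ^ k" for k
  proof -
    have "measure P (B k) \<le> (\<Sum>i<2 ^ k. measure P (kolmogorov_jump T a k i))"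
      unfolding B_def by (intro finite_measure_subadditive_finite) (auto intro: jump)
    also have "\<dots> \<le> (\<Sum>i<(2::nat) ^ k. c * (T / 2 ^ k)\<^sup>2 / (a * (9 / 10) ^ k) ^ 4)"
    proof (rule sum_mono)
      fix i :: nat assume i: "i \<in> {..<2 ^ k}"
      have d: "T * (real (Suc i) / 2 ^ k) - T * (real i / 2 ^ k) = T / 2 ^ k"
        by (simp add: field_simps)
      show "measure P (kolmogorov_jump T a k i) \<le> c * (T / 2 ^ k)\<^sup>2 / (a * (9 / 10) ^ k) ^ 4"
        unfolding kolmogorov_jump_def d[symmetric]
      proof (rule incr)
        show "T * (real i / 2 ^ k) < T * (real (Suc i) / 2 ^ k)"
          using d T by (metis diff_gt_0_iff_gt divide_pos_pos zero_less_numeral zero_less_power)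
      qed (use i T a dyadic_time_in[OF T, of "Suc i" k] dyadic_time_in[OF T, of i k] in auto)
    qed
    also have "\<dots> = 2 ^ k * (c * (T / 2 ^ k)\<^sup>2 / (a * (9 / 10) ^ k) ^ 4)"
      by simp
    also have "\<dots> = c * T\<^sup>2 / a ^ 4 * (2 ^ k / ((2 ^ k)\<^sup>2 * ((9 / 10) ^ k) ^ 4))"
      by (simp add: power_mult_distrib power_divide mult_ac)
    also have "2 ^ k / ((2 ^ k)\<^sup>2 * ((9 / 10) ^ k) ^ 4) = (2 / (2\<^sup>2 * (9 / 10 :: real) ^ 4)) ^ k"
      unfolding power_divide[of 2] power_mult_distrib power_mult[symmetric]
      by (simp add: mult.commute)
    also have "2 / (2\<^sup>2 * (9 / 10 :: real) ^ 4) = 10000 / 13122"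
      by (simp add: power_divide)
    finally show ?thesis .
  qed
  have geo: "summable (\<lambda>k. c * T\<^sup>2 / a ^ 4 * (10000 / 13122) ^ k)"
    by (intro summable_mult summable_geometric) simp
  have sumB: "summable (\<lambda>k. measure P (B k))"
    by (rule summable_comparison_test'[OF geo, of 0]) (use B_le in auto)
  have "measure P (\<Union>k. B k) \<le> (\<Sum>k. measure P (B k))"
    by (rule finite_measure_subadditive_countably) (use B_sets sumB in auto)
  also have "\<dots> \<le> (\<Sum>k. c * T\<^sup>2 / a ^ 4 * (10000 / 13122) ^ k)"
    by (intro suminf_le B_le sumB geo)
  also have "\<dots> = c * T\<^sup>2 / a ^ 4 * (1 / (1 - 10000 / 13122))"
    by (subst suminf_mult) (auto simp: suminf_geometric intro: summable_geometric)
  \<comment> \<open>The geometric factor is 13122 / 3122, about 4.2, rounded up to 5.\<close>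
  also have "\<dots> \<le> c * T\<^sup>2 / a ^ 4 * 5"
    using a c by (intro mult_left_mono) auto
  finally have UB: "measure P (\<Union>k. B k) \<le> 5 * c * T\<^sup>2 / a ^ 4"
    by (simp add: mult_ac)
  have N: "{\<omega> \<in> \<Omega> T. \<omega> 0 \<noteq> 0} \<in> sets P"
    using path_start_measurable[OF T] P(2) by simp
  have "prob {\<omega> \<in> \<Omega> T. \<omega> 0 \<noteq> 0} = 0"
    using start N by (subst prob_eq_0) (auto simp: sp)
  then have "measure P (\<Omega> T - kolmogorov_set T a) \<le> 0 + measure P (\<Union>k. B k)"
    unfolding compl_kolmogorov_set B_def[symmetric]
    using measure_Un_le[OF N, of "\<Union>k. B k"] B_sets by auto
  with UB show ?thesis by simp
qed

subsection \<open>Sublinear expectations and the completion\<close>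

context
  fixes W :: "'w set" and H :: "('w \<Rightarrow> real) set" and E :: "('w \<Rightarrow> real) \<Rightarrow> real"
  assumes SE: "sublinear_expectation W H E"
begin

lemma sublinear_const_in: "(\<lambda>_. c) \<in> H"
  and sublinear_add_in: "X \<in> H \<Longrightarrow> Y \<in> H \<Longrightarrow> (\<lambda>w. X w + Y w) \<in> H"
  and sublinear_scale_in: "X \<in> H \<Longrightarrow> (\<lambda>w. c * X w) \<in> H"
  and sublinear_abs_in: "X \<in> H \<Longrightarrow> (\<lambda>w. \<bar>X w\<bar>) \<in> H"
  and sublinear_mono: "X \<in> H \<Longrightarrow> Y \<in> H \<Longrightarrow> (\<And>w. w \<in> W \<Longrightarrow> X w \<le> Y w) \<Longrightarrow> E X \<le> E Y"
  and sublinear_const: "E (\<lambda>_. c) = c"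
  and sublinear_subadd: "X \<in> H \<Longrightarrow> Y \<in> H \<Longrightarrow> E (\<lambda>w. X w + Y w) \<le> E X + E Y"
  and sublinear_poshom: "X \<in> H \<Longrightarrow> 0 \<le> c \<Longrightarrow> E (\<lambda>w. c * X w) = c * E X"
  using SE unfolding sublinear_expectation_def by blast+

lemma sublinear_diff_in:
  assumes "X \<in> H" "Y \<in> H"
  shows "(\<lambda>w. X w - Y w) \<in> H"
  using sublinear_add_in[OF assms(1) sublinear_scale_in[OF assms(2), of "-1"]] by simp

lemma sublinear_absdiff_in: "X \<in> H \<Longrightarrow> Y \<in> H \<Longrightarrow> (\<lambda>w. \<bar>X w - Y w\<bar>) \<in> H"
  by (intro sublinear_abs_in sublinear_diff_in)

lemma sublinear_nonneg: "X \<in> H \<Longrightarrow> (\<And>w. w \<in> W \<Longrightarrow> 0 \<le> X w) \<Longrightarrow> 0 \<le> E X"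
  using sublinear_mono[OF sublinear_const_in, of X 0] sublinear_const[of 0] by simp

text \<open>Monotonicity and subadditivity applied to
  \<open>X w \<le> Y w + \<bar>X w - Y w\<bar>\<close>, in both orders.\<close>

lemma sublinear_contraction:
  assumes "X \<in> H" "Y \<in> H"
  shows "\<bar>E X - E Y\<bar> \<le> E (\<lambda>w. \<bar>X w - Y w\<bar>)"
proof -
  have *: "E X \<le> E Y + E (\<lambda>w. \<bar>X w - Y w\<bar>)" if "X \<in> H" "Y \<in> H" for X Y
  proof -
    have "E X \<le> E (\<lambda>w. Y w + \<bar>X w - Y w\<bar>)"
      using that by (intro sublinear_mono sublinear_add_in sublinear_absdiff_in) auto
    also have "\<dots> \<le> E Y + E (\<lambda>w. \<bar>X w - Y w\<bar>)"
      using that by (intro sublinear_subadd sublinear_absdiff_in)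
    finally show ?thesis .
  qed
  have "E (\<lambda>w. \<bar>Y w - X w\<bar>) = E (\<lambda>w. \<bar>X w - Y w\<bar>)"
    by (simp only: abs_minus_commute)
  with *[OF assms] *[OF assms(2,1)] show ?thesis
    by linarith
qed

text \<open>With c = 1, with c = -1 or with zero for X, this one estimate covers sums, differences
  and multiples.\<close>

lemma sublinear_lincomb_dist:
  assumes "X \<in> H" "Y \<in> H" "X' \<in> H" "Y' \<in> H"
  shows "E (\<lambda>w. \<bar>X w + c * Y w - (X' w + c * Y' w)\<bar>) \<le> E (\<lambda>w. \<bar>X w - X' w\<bar>) + \<bar>c\<bar> * E (\<lambda>w. \<bar>Y w - Y' w\<bar>)"
proof -
  have "\<bar>a + c * b - (a' + c * b')\<bar> \<le> \<bar>a - a'\<bar> + \<bar>c\<bar> * \<bar>b - b'\<bar>" for a a' b b'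
  proof -
    have "a + c * b - (a' + c * b') = (a - a') + c * (b - b')"
      by (simp add: algebra_simps)
    then show ?thesis
      using abs_triangle_ineq[of "a - a'" "c * (b - b')"] by (simp only: abs_mult)
  qed
  then have "E (\<lambda>w. \<bar>X w + c * Y w - (X' w + c * Y' w)\<bar>) \<le> E (\<lambda>w. \<bar>X w - X' w\<bar> + \<bar>c\<bar> * \<bar>Y w - Y' w\<bar>)"
    using assms by (intro sublinear_mono sublinear_absdiff_in sublinear_add_in sublinear_scale_in)
  also have "\<dots> \<le> E (\<lambda>w. \<bar>X w - X' w\<bar>) + E (\<lambda>w. \<bar>c\<bar> * \<bar>Y w - Y' w\<bar>)"
    using assms by (intro sublinear_subadd sublinear_absdiff_in sublinear_scale_in)
  also have "E (\<lambda>w. \<bar>c\<bar> * \<bar>Y w - Y' w\<bar>) = \<bar>c\<bar> * E (\<lambda>w. \<bar>Y w - Y' w\<bar>)"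
    using assms by (intro sublinear_poshom sublinear_absdiff_in) auto
  finally show ?thesis .
qed

end

section \<open>Cylinder functions: growth classes, continuity, integrability\<close>

lemma C_bLip_subset_C_lLip: "C_bLip n \<subseteq> C_lLip n"
proof
  fix \<phi> assume "\<phi> \<in> C_bLip n"
  then obtain C where C: "\<And>x y. \<bar>\<phi> x - \<phi> y\<bar> \<le> C * L2_set (\<lambda>i. x i - y i) {..<n}"
    unfolding C_bLip_def by blast
  \<comment> \<open>Exponent 0 turns the growth factor into the constant 3; the absolute value
    covers a negative C.\<close>
  have "\<bar>\<phi> x - \<phi> y\<bar> \<le> \<bar>C\<bar> * (1 + L2_set x {..<n} ^ 0 + L2_set y {..<n} ^ 0) * L2_set (\<lambda>i. x i - y i) {..<n}" for x y
  proof -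
    have "C * L2_set (\<lambda>i. x i - y i) {..<n} \<le> (\<bar>C\<bar> * 3) * L2_set (\<lambda>i. x i - y i) {..<n}"
      by (intro mult_right_mono) auto
    with C[of x y] show ?thesis by simp
  qed
  then show "\<phi> \<in> C_lLip n"
    unfolding C_lLip_def by blast
qed

lemma L_ip_bounded:
  assumes "X \<in> L_ip T"
  obtains C where "\<And>\<omega>. \<bar>X \<omega>\<bar> \<le> C"
  using assms unfolding L_ip_def C_bLip_def by blast

text \<open>An increment involves at most two evaluations, so it moves by at most twice the uniform
  distance; n coordinates give the Lipschitz constant \<open>\<bar>C\<bar> * (2 * n)\<close>.
  Continuity makes cylinder functions test functions for weak convergence.\<close>

lemma L_ip_continuous:
  assumes T: "0 < T" and X: "X \<in> L_ip T"
  shows "continuous_map (mtopology_of (path_metric T)) euclideanreal X"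
proof -
  interpret Metric_space "\<Omega> T" "mdist (path_metric T)"
    by (rule Metric_space_mspace_mdist)
  obtain n t \<phi> where X_eq: "X = (\<lambda>\<omega>. \<phi> (increments t \<omega>))" and grid: "time_grid T n t" and \<phi>: "\<phi> \<in> C_bLip n"
    using X unfolding L_ip_def by blast
  obtain C where C: "\<And>x y. \<bar>\<phi> x - \<phi> y\<bar> \<le> C * L2_set (\<lambda>i. x i - y i) {..<n}"
    using \<phi> unfolding C_bLip_def by blast
  have "\<bar>X \<omega> - X \<omega>'\<bar> \<le> (\<bar>C\<bar> * (2 * n)) * mdist (path_metric T) \<omega> \<omega>'"
    if w: "\<omega> \<in> \<Omega> T" "\<omega>' \<in> \<Omega> T" for \<omega> \<omega>'
  proof -
    let ?d = "mdist (path_metric T) \<omega> \<omega>'"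
    have d: "\<bar>\<omega> (t i) - \<omega>' (t i)\<bar> \<le> ?d" if "i < n" for i
      using grid that T by (intro path_diff_le_mdist w) (auto simp: time_grid_def)
    have "\<bar>increments t \<omega> i - increments t \<omega>' i\<bar> \<le> 2 * ?d" if "i < n" for i
    proof (cases "i = 0")
      case True
      then show ?thesis using d[of 0] that nonneg[of \<omega> \<omega>'] by (simp add: increments_def)
    next
      case False
      have "i - 1 < n" using that by simp
      from d[OF that] d[OF this] False show ?thesis by (simp add: increments_def)
    qed
    then have "(\<Sum>i<n. \<bar>increments t \<omega> i - increments t \<omega>' i\<bar>) \<le> real n * (2 * ?d)"
      using sum_bounded_above[of "{..<n}" "\<lambda>i. \<bar>increments t \<omega> i - increments t \<omega>' i\<bar>" "2 * ?d"] by simp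
    then have "L2_set (\<lambda>i. increments t \<omega> i - increments t \<omega>' i) {..<n} \<le> real n * (2 * ?d)"
      by (rule order_trans[OF L2_set_le_sum_abs])
    then have "\<bar>C\<bar> * L2_set (\<lambda>i. increments t \<omega> i - increments t \<omega>' i) {..<n} \<le> \<bar>C\<bar> * (real n * (2 * ?d))"
      by (rule mult_left_mono) simp
    moreover have "C * L2_set (\<lambda>i. increments t \<omega> i - increments t \<omega>' i) {..<n}
        \<le> \<bar>C\<bar> * L2_set (\<lambda>i. increments t \<omega> i - increments t \<omega>' i) {..<n}"
      by (intro mult_right_mono) auto
    ultimately show ?thesis
      using C[of "increments t \<omega>" "increments t \<omega>'"] unfolding X_eq by (simp add: mult_ac)
  qed
  then have "Lipschitz_continuous_map (path_metric T) euclidean_metric X"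
    unfolding Lipschitz_continuous_map_def dist_real_def mdist_euclidean_metric
    by (intro conjI exI[of _ "\<bar>C\<bar> * (2 * n)"]) (auto simp: dist_real_def)
  then have "continuous_map (mtopology_of (path_metric T)) (mtopology_of euclidean_metric) X"
    by (rule Lipschitz_continuous_imp_continuous_map)
  then show ?thesis by simp
qed

lemma L_ip_integrable:
  assumes "0 < T" "X \<in> L_ip T" "prob_space P" "sets P = sets (path_borel T)"
  shows "integrable P X"
proof -
  interpret prob_space P by fact
  obtain C where C: "\<And>\<omega>. \<bar>X \<omega>\<bar> \<le> C"
    using L_ip_bounded assms(2) by blast
  have "X \<in> borel_measurable P"
    using path_continuous_measurable[OF L_ip_continuous[OF assms(1,2)]]
    by (simp add: measurable_cong_sets[OF assms(4) refl])
  then show ?thesis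
    using C by (intro integrable_const_bound[of _ C]) auto
qed

section \<open>The completion: equivalence classes, linear operations, extension of
  functionals\<close>

context
  fixes T :: real and E :: "rv \<Rightarrow> real"
  assumes SE: "sublinear_expectation (\<Omega> T) (L_ip T) E"
begin

lemma G_Cauchy_D: "X \<in> G_Cauchy T E \<Longrightarrow> X n \<in> L_ip T"
  unfolding G_Cauchy_def by simp

lemma G_Cauchy_E:
  assumes "X \<in> G_Cauchy T E" "0 < e"
  obtains N where "\<And>m n. m \<ge> N \<Longrightarrow> n \<ge> N \<Longrightarrow> E (\<lambda>\<omega>. \<bar>X m \<omega> - X n \<omega>\<bar>) < e"
proof -
  have "\<exists>N. \<forall>m\<ge>N. \<forall>n\<ge>N. E (\<lambda>\<omega>. \<bar>X m \<omega> - X n \<omega>\<bar>) < e"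
    using assms unfolding G_Cauchy_def by simp
  then show ?thesis
    using that by blast
qed

lemma G_Cauchy_const: "X \<in> L_ip T \<Longrightarrow> (\<lambda>_. X) \<in> G_Cauchy T E"
  unfolding G_Cauchy_def by (simp add: sublinear_const[OF SE])

lemma G_Cauchy_lincomb:
  assumes X: "X \<in> G_Cauchy T E" and Y: "Y \<in> G_Cauchy T E"
  shows "(\<lambda>n \<omega>. X n \<omega> + c * Y n \<omega>) \<in> G_Cauchy T E"
  unfolding G_Cauchy_def
proof (intro CollectI conjI allI impI)
  note L = G_Cauchy_D[OF X] G_Cauchy_D[OF Y]
  show "(\<lambda>\<omega>. X n \<omega> + c * Y n \<omega>) \<in> L_ip T" for n
    by (intro sublinear_add_in[OF SE] sublinear_scale_in[OF SE] L)
  fix e :: real assume e: "e > 0"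
  obtain N1 where N1: "\<And>m n. m \<ge> N1 \<Longrightarrow> n \<ge> N1 \<Longrightarrow> E (\<lambda>\<omega>. \<bar>X m \<omega> - X n \<omega>\<bar>) < e / 2"
    using G_Cauchy_E[OF X half_gt_zero[OF e]] by blast
  have "e / (2 * (\<bar>c\<bar> + 1)) > 0" using e by (simp add: divide_pos_pos)
  then obtain N2 where N2: "\<And>m n. m \<ge> N2 \<Longrightarrow> n \<ge> N2 \<Longrightarrow> E (\<lambda>\<omega>. \<bar>Y m \<omega> - Y n \<omega>\<bar>) < e / (2 * (\<bar>c\<bar> + 1))"
    using G_Cauchy_E[OF Y] by blast
  have "E (\<lambda>\<omega>. \<bar>X m \<omega> + c * Y m \<omega> - (X n \<omega> + c * Y n \<omega>)\<bar>) < e"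
    if "m \<ge> max N1 N2" "n \<ge> max N1 N2" for m n
  proof -
    have "\<bar>c\<bar> * E (\<lambda>\<omega>. \<bar>Y m \<omega> - Y n \<omega>\<bar>) \<le> (\<bar>c\<bar> + 1) * (e / (2 * (\<bar>c\<bar> + 1)))"
      using N2[of m n] that
      by (intro mult_mono sublinear_nonneg[OF SE] sublinear_absdiff_in[OF SE] L) auto
    also have "\<dots> = e / 2"
    proof -
      have "\<bar>c\<bar> + 1 \<noteq> 0" by linarith
      then show ?thesis by (simp add: field_simps)
    qed
    finally show ?thesis
      using sublinear_lincomb_dist[OF SE L(1)[of m] L(2)[of m] L(1)[of n] L(2)[of n], of c] N1[of m n] that by simp
  qed
  then show "\<exists>N. \<forall>m\<ge>N. \<forall>n\<ge>N. E (\<lambda>\<omega>. \<bar>X m \<omega> + c * Y m \<omega> - (X n \<omega> + c * Y n \<omega>)\<bar>) < e"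
    by blast
qed

lemma G_Cauchy_zero: "(\<lambda>n \<omega>. 0) \<in> G_Cauchy T E"
  by (intro G_Cauchy_const sublinear_const_in[OF SE])

lemma G_Cauchy_scale: "X \<in> G_Cauchy T E \<Longrightarrow> (\<lambda>n \<omega>. c * X n \<omega>) \<in> G_Cauchy T E"
  using G_Cauchy_lincomb[OF G_Cauchy_zero, of X c] by simp

lemma G_rel_refl: "X \<in> G_Cauchy T E \<Longrightarrow> (X, X) \<in> G_rel T E"
  unfolding G_rel_def by (simp add: sublinear_const[OF SE])

lemma G_rel_lincomb:
  assumes X: "(X, X') \<in> G_rel T E" and Y: "(Y, Y') \<in> G_rel T E"
  shows "((\<lambda>n \<omega>. X n \<omega> + c * Y n \<omega>), (\<lambda>n \<omega>. X' n \<omega> + c * Y' n \<omega>)) \<in> G_rel T E"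
proof -
  have C: "X \<in> G_Cauchy T E" "X' \<in> G_Cauchy T E" "Y \<in> G_Cauchy T E" "Y' \<in> G_Cauchy T E"
    and lim: "(\<lambda>n. E (\<lambda>\<omega>. \<bar>X n \<omega> - X' n \<omega>\<bar>)) \<longlonglongrightarrow> 0" "(\<lambda>n. E (\<lambda>\<omega>. \<bar>Y n \<omega> - Y' n \<omega>\<bar>)) \<longlonglongrightarrow> 0"
    using X Y unfolding G_rel_def by auto
  note L = C[THEN G_Cauchy_D]
  have "(\<lambda>n. E (\<lambda>\<omega>. \<bar>X n \<omega> - X' n \<omega>\<bar>) + \<bar>c\<bar> * E (\<lambda>\<omega>. \<bar>Y n \<omega> - Y' n \<omega>\<bar>)) \<longlonglongrightarrow> 0 + \<bar>c\<bar> * 0"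
    by (intro tendsto_intros lim)
  then have up: "(\<lambda>n. E (\<lambda>\<omega>. \<bar>X n \<omega> - X' n \<omega>\<bar>) + \<bar>c\<bar> * E (\<lambda>\<omega>. \<bar>Y n \<omega> - Y' n \<omega>\<bar>)) \<longlonglongrightarrow> 0"
    by simp
  have "(\<lambda>n. E (\<lambda>\<omega>. \<bar>X n \<omega> + c * Y n \<omega> - (X' n \<omega> + c * Y' n \<omega>)\<bar>)) \<longlonglongrightarrow> 0"
  proof (rule tendsto_sandwich[OF _ _ tendsto_const up])
    show "\<forall>\<^sub>F n in sequentially. 0 \<le> E (\<lambda>\<omega>. \<bar>X n \<omega> + c * Y n \<omega> - (X' n \<omega> + c * Y' n \<omega>)\<bar>)"
      by (intro always_eventually allI sublinear_nonneg[OF SE] sublinear_absdiff_in[OF SE]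
          sublinear_add_in[OF SE] sublinear_scale_in[OF SE] L) auto
    show "\<forall>\<^sub>F n in sequentially. E (\<lambda>\<omega>. \<bar>X n \<omega> + c * Y n \<omega> - (X' n \<omega> + c * Y' n \<omega>)\<bar>)
        \<le> E (\<lambda>\<omega>. \<bar>X n \<omega> - X' n \<omega>\<bar>) + \<bar>c\<bar> * E (\<lambda>\<omega>. \<bar>Y n \<omega> - Y' n \<omega>\<bar>)"
      by (intro always_eventually allI sublinear_lincomb_dist[OF SE] L)
  qed
  with C show ?thesis
    unfolding G_rel_def by (auto intro: G_Cauchy_lincomb)
qed

lemma G_rel_equiv: "equiv (G_Cauchy T E) (G_rel T E)"
proof (rule equivI)
  show "G_rel T E \<subseteq> G_Cauchy T E \<times> G_Cauchy T E"
    unfolding G_rel_def by auto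
  show "refl_on (G_Cauchy T E) (G_rel T E)"
    by (rule refl_onI) (rule G_rel_refl)
  show "sym (G_rel T E)"
    unfolding G_rel_def by (auto intro!: symI simp: abs_minus_commute)
  show "trans (G_rel T E)"
  proof (rule transI)
    fix X Y Z assume XY: "(X, Y) \<in> G_rel T E" and YZ: "(Y, Z) \<in> G_rel T E"
    then have "(Y, Y) \<in> G_rel T E"
      by (intro G_rel_refl) (auto simp: G_rel_def)
    \<comment> \<open>Adding the two relations gives (X + Y, Y + Z); subtracting (Y, Y) leaves (X,
      Z).\<close>
    from G_rel_lincomb[OF G_rel_lincomb[OF XY YZ, of 1] this, of "-1"]
    show "(X, Z) \<in> G_rel T E" by simp
  qed
qed

lemma L_G1_cases:
  assumes "\<xi> \<in> L_G1 T E"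
  obtains X where "X \<in> G_Cauchy T E" "\<xi> = G_rel T E `` {X}"
  using assms unfolding L_G1_def by (rule quotientE)

lemma L_G1_class: "X \<in> G_Cauchy T E \<Longrightarrow> G_rel T E `` {X} \<in> L_G1 T E"
  unfolding L_G1_def by (rule quotientI)

text \<open>The operations are unions over all representatives; compatibility with the relation
  collapses them to one class. The perturbed variable thus gets an explicit representing
  sequence.\<close>

lemma L_G1_lincomb_class:
  assumes X: "X \<in> G_Cauchy T E" and Y: "Y \<in> G_Cauchy T E"
  shows "L_G1_add T E (G_rel T E `` {X}) (L_G1_scale T E c (G_rel T E `` {Y})) =
    G_rel T E `` {\<lambda>n \<omega>. X n \<omega> + c * Y n \<omega>}"
proof -
  have zero: "((\<lambda>n \<omega>. 0), (\<lambda>n \<omega>. 0)) \<in> G_rel T E"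
    by (rule G_rel_refl[OF G_Cauchy_zero])
  have "(\<lambda>X. G_rel T E `` {\<lambda>n \<omega>. c * X n \<omega>}) respects G_rel T E"
    using G_rel_lincomb[OF zero, of _ _ c]
    by (intro congruentI equiv_class_eq[OF G_rel_equiv]) simp
  then have scale: "L_G1_scale T E c (G_rel T E `` {Y}) = G_rel T E `` {\<lambda>n \<omega>. c * Y n \<omega>}"
    unfolding L_G1_scale_def by (rule UN_equiv_class[OF G_rel_equiv _ Y])
  have "(\<lambda>X Y. G_rel T E `` {\<lambda>n \<omega>. X n \<omega> + Y n \<omega>}) respects2 G_rel T E"
    using G_rel_lincomb[of _ _ _ _ 1]
    by (intro congruent2I' equiv_class_eq[OF G_rel_equiv]) simp
  then show ?thesis
    unfolding scale L_G1_add_def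
    by (rule UN_equiv_class2[OF G_rel_equiv G_rel_equiv _ X G_Cauchy_scale[OF Y]])
qed

text \<open>The Lipschitz bound in the \<open>E\<close>-seminorm alone yields convergence and
  independence of the representative. So one lemma extends \<open>E\<close>, every dominated
  integral, and the map taking X to
  \<open>E (\<lambda>\<omega>. \<bar>X \<omega>\<bar>)\<close>.\<close>

lemma contraction_extension:
  assumes F: "\<And>X Y. X \<in> L_ip T \<Longrightarrow> Y \<in> L_ip T \<Longrightarrow> \<bar>F X - F Y\<bar> \<le> E (\<lambda>\<omega>. \<bar>X \<omega> - Y \<omega>\<bar>)"
    and X: "X \<in> G_Cauchy T E"
  shows "has_extension F (G_rel T E `` {X}) (extension F (G_rel T E `` {X}))"
    and "(\<lambda>n. F (X n)) \<longlonglongrightarrow> extension F (G_rel T E `` {X})"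
proof -
  note L = G_Cauchy_D
  have "Cauchy (\<lambda>n. F (X n))"
    unfolding Cauchy_def dist_real_def
  proof (intro allI impI)
    fix e :: real assume "e > 0"
    then obtain N where N: "\<And>m n. m \<ge> N \<Longrightarrow> n \<ge> N \<Longrightarrow> E (\<lambda>\<omega>. \<bar>X m \<omega> - X n \<omega>\<bar>) < e"
      using G_Cauchy_E[OF X] by blast
    then show "\<exists>M. \<forall>m\<ge>M. \<forall>n\<ge>M. \<bar>F (X m) - F (X n)\<bar> < e"
      using F[OF L[OF X] L[OF X]] by (meson le_less_trans)
  qed
  then obtain l where l: "(\<lambda>n. F (X n)) \<longlonglongrightarrow> l"
    using Cauchy_convergent convergentD by blast
  have ext: "has_extension F (G_rel T E `` {X}) l"
    unfolding has_extension_def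
  proof
    fix Y assume "Y \<in> G_rel T E `` {X}"
    then have Y: "Y \<in> G_Cauchy T E" "(\<lambda>n. E (\<lambda>\<omega>. \<bar>X n \<omega> - Y n \<omega>\<bar>)) \<longlonglongrightarrow> 0"
      unfolding G_rel_def by auto
    have "(\<lambda>n. F (X n) - F (Y n)) \<longlonglongrightarrow> 0"
      by (rule Lim_null_comparison[OF _ Y(2)])
        (unfold real_norm_def, intro always_eventually allI F L X Y)
    from tendsto_diff[OF l this] show "(\<lambda>n. F (Y n)) \<longlonglongrightarrow> l"
      by simp
  qed
  have mem: "X \<in> G_rel T E `` {X}"
    using G_rel_refl[OF X] by blast
  have "extension F (G_rel T E `` {X}) = l"
    unfolding extension_def
  proof (rule the_equality)
    show "has_extension F (G_rel T E `` {X}) l"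
      by (rule ext)
  next
    fix l' assume "has_extension F (G_rel T E `` {X}) l'"
    then have "(\<lambda>n. F (X n)) \<longlonglongrightarrow> l'"
      using mem unfolding has_extension_def by blast
    then show "l' = l"
      using l LIMSEQ_unique by blast
  qed
  with ext l show "has_extension F (G_rel T E `` {X}) (extension F (G_rel T E `` {X}))"
    and "(\<lambda>n. F (X n)) \<longlonglongrightarrow> extension F (G_rel T E `` {X})"
    by auto
qed

lemmas E_contraction = sublinear_contraction[OF SE]

lemma dominated_contraction:
  assumes T: "0 < T" and P: "prob_space P" "sets P = sets (path_borel T)"
    and dom: "\<And>X. X \<in> L_ip T \<Longrightarrow> integral\<^sup>L P X \<le> E X"
    and X: "X \<in> L_ip T" and Y: "Y \<in> L_ip T"
  shows "\<bar>integral\<^sup>L P X - integral\<^sup>L P Y\<bar> \<le> E (\<lambda>\<omega>. \<bar>X \<omega> - Y \<omega>\<bar>)"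
proof -
  have int: "integrable P X" "integrable P Y"
    using L_ip_integrable[OF T _ P] X Y by auto
  have "\<bar>integral\<^sup>L P X - integral\<^sup>L P Y\<bar> = \<bar>\<integral>\<omega>. X \<omega> - Y \<omega> \<partial>P\<bar>"
    using int by simp
  also have "\<dots> \<le> (\<integral>\<omega>. \<bar>X \<omega> - Y \<omega>\<bar> \<partial>P)"
    by (rule integral_abs_bound)
  also have "\<dots> \<le> E (\<lambda>\<omega>. \<bar>X \<omega> - Y \<omega>\<bar>)"
    by (intro dom sublinear_absdiff_in[OF SE] X Y)
  finally show ?thesis .
qed

text \<open>Constant sequences give one direction, limits of inequalities the other. The right-hand
  side tests P against bounded continuous functions only, so it survives weak limits.\<close>

lemma representing_measures_iff:
  assumes T: "0 < T"
  shows "P \<in> \<P> T E \<longleftrightarrow> prob_space P \<and> sets P = sets (path_borel T) \<and>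
    (\<forall>X\<in>L_ip T. integral\<^sup>L P X \<le> E X)"
proof (intro iffI conjI ballI; (elim conjE)?)
  assume P: "P \<in> \<P> T E"
  then show "prob_space P" "sets P = sets (path_borel T)"
    unfolding \<P>_def by auto
next
  assume P: "P \<in> \<P> T E"
  fix X assume X: "X \<in> L_ip T"
  let ?c = "G_rel T E `` {\<lambda>_. X}"
  have C: "(\<lambda>_. X) \<in> G_Cauchy T E"
    by (rule G_Cauchy_const[OF X])
  have mem: "(\<lambda>_. X) \<in> ?c"
    using G_rel_refl[OF C] by blast
  obtain l where "has_extension (integral\<^sup>L P) ?c l" and le: "extension (integral\<^sup>L P) ?c \<le> extension E ?c"
    using P L_G1_class[OF C] unfolding \<P>_def by blast
  \<comment> \<open>Any extension must agree with the integral on the constant representative; with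
    the existence demanded in \<open>\<P>\<close> this pins down the value of
    \<open>extension\<close>.\<close>
  have unique: "l = integral\<^sup>L P X" if "has_extension (integral\<^sup>L P) ?c l" for l
    using bspec[OF that[unfolded has_extension_def] mem] by (simp add: LIMSEQ_const_iff)
  have "extension (integral\<^sup>L P) ?c = integral\<^sup>L P X"
    unfolding extension_def
  proof (rule the_equality)
    show "has_extension (integral\<^sup>L P) ?c (integral\<^sup>L P X)"
      using unique \<open>has_extension (integral\<^sup>L P) ?c l\<close> by metis
  qed (rule unique)
  moreover have "extension E ?c = E X"
  proof -
    have "(\<lambda>n. E X) \<longlonglongrightarrow> extension E ?c"
      using contraction_extension(2)[where F=E, OF E_contraction C] .
    then show ?thesis
      unfolding LIMSEQ_const_iff by (rule sym)
  qed
  ultimately show "integral\<^sup>L P X \<le> E X"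
    using le by simp
next
  assume P: "prob_space P" "sets P = sets (path_borel T)" and dom: "\<forall>X\<in>L_ip T. integral\<^sup>L P X \<le> E X"
  have con: "\<bar>integral\<^sup>L P X - integral\<^sup>L P Y\<bar> \<le> E (\<lambda>\<omega>. \<bar>X \<omega> - Y \<omega>\<bar>)" if "X \<in> L_ip T" "Y \<in> L_ip T" for X Y
    by (rule dominated_contraction[OF T P]) (use dom that in auto)
  have "(\<exists>l. has_extension (integral\<^sup>L P) \<xi> l) \<and> extension (integral\<^sup>L P) \<xi> \<le> extension E \<xi>"
    if \<xi>: "\<xi> \<in> L_G1 T E" for \<xi>
  proof -
    obtain X where X: "X \<in> G_Cauchy T E" "\<xi> = G_rel T E `` {X}"
      using \<xi> by (rule L_G1_cases)
    have "extension (integral\<^sup>L P) \<xi> \<le> extension E \<xi>"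
      unfolding X(2)
      by (rule LIMSEQ_le[OF contraction_extension(2)[where F="integral\<^sup>L P", OF con X(1)]
            contraction_extension(2)[where F=E, OF E_contraction X(1)]])
        (use dom G_Cauchy_D[OF X(1)] in auto)
    then show ?thesis
      using contraction_extension(1)[where F="integral\<^sup>L P", OF con X(1)] X(2) by blast
  qed
  with P show "P \<in> \<P> T E"
    unfolding \<P>_def using sets_eq_imp_space_eq[OF P(2)] by auto
qed

end

subsection \<open>Tightness of the representing measures\<close>

lemma abs_le_L2_set:
  fixes f :: "nat \<Rightarrow> real"
  assumes "i < n"
  shows "\<bar>f i\<bar> \<le> L2_set f {..<n}"
  using member_le_L2_set[OF finite_lessThan, of i n "\<lambda>i. \<bar>f i\<bar>"] assms by (simp add: L2_set_def)

lemma fourth_power_diff_le: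
  fixes p q M :: real
  assumes "\<bar>p\<bar> \<le> M" "\<bar>q\<bar> \<le> M"
  shows "\<bar>p ^ 4 - q ^ 4\<bar> \<le> 4 * M ^ 3 * \<bar>p - q\<bar>"
proof -
  have M: "0 \<le> M" using assms(1) by linarith
  have 1: "\<bar>p ^ 3\<bar> \<le> M ^ 3" "\<bar>q ^ 3\<bar> \<le> M ^ 3"
    unfolding power_abs by (intro power_mono assms abs_ge_zero)+
  have 2: "\<bar>p\<^sup>2 * q\<bar> \<le> M\<^sup>2 * M" "\<bar>p * q\<^sup>2\<bar> \<le> M * M\<^sup>2"
    unfolding abs_mult power_abs
    by (intro mult_mono power_mono assms zero_le_power abs_ge_zero M)+
  have "p ^ 4 - q ^ 4 = (p ^ 3 + p\<^sup>2 * q + p * q\<^sup>2 + q ^ 3) * (p - q)"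
    by (simp add: algebra_simps power2_eq_square power3_eq_cube power4_eq_xxxx)
  then have "\<bar>p ^ 4 - q ^ 4\<bar> = \<bar>p ^ 3 + p\<^sup>2 * q + p * q\<^sup>2 + q ^ 3\<bar> * \<bar>p - q\<bar>"
    by (simp add: abs_mult)
  also have "\<dots> \<le> (4 * M ^ 3) * \<bar>p - q\<bar>"
  proof (rule mult_right_mono)
    have eq: "M\<^sup>2 * M = M ^ 3" "M * M\<^sup>2 = M ^ 3"
      by (simp_all add: power2_eq_square power3_eq_cube)
    have "\<bar>a + b + c + e\<bar> \<le> 4 * m" if "\<bar>a\<bar> \<le> m" "\<bar>b\<bar> \<le> m" "\<bar>c\<bar> \<le> m" "\<bar>e\<bar> \<le> m" for a b c e m :: real
      using that by linarith
    then show "\<bar>p ^ 3 + p\<^sup>2 * q + p * q\<^sup>2 + q ^ 3\<bar> \<le> 4 * M ^ 3"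
      using 1 2[unfolded eq] by blast
  qed simp
  finally show ?thesis .
qed

text \<open>Polynomial growth is allowed in \<open>C_lLip\<close>, so the fourth power of a G-normal
  variable stays in \<open>H\<close> and its sublinear moment is available as a real
  constant.\<close>

lemma fourth_power_C_lLip: "(\<lambda>x. x 0 ^ 4) \<in> C_lLip 1"
  unfolding C_lLip_def
proof (intro CollectI exI allI)
  fix x y :: "nat \<Rightarrow> real"
  have "{..<1} = {0::nat}" by auto
  then have L: "L2_set f {..<1} = \<bar>f 0\<bar>" for f :: "nat \<Rightarrow> real"
    by (simp add: L2_set_def)
  have "max \<bar>x 0\<bar> \<bar>y 0\<bar> ^ 3 \<le> 1 + \<bar>x 0\<bar> ^ 3 + \<bar>y 0\<bar> ^ 3"
    by (auto simp: max_def)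
  then have "4 * max \<bar>x 0\<bar> \<bar>y 0\<bar> ^ 3 * \<bar>x 0 - y 0\<bar> \<le> 4 * (1 + \<bar>x 0\<bar> ^ 3 + \<bar>y 0\<bar> ^ 3) * \<bar>x 0 - y 0\<bar>"
    by (intro mult_right_mono) auto
  then show "\<bar>x 0 ^ 4 - y 0 ^ 4\<bar> \<le> 4 * (1 + L2_set x {..<1} ^ 3 + L2_set y {..<1} ^ 3) * L2_set (\<lambda>i. x i - y i) {..<1}"
    unfolding L using fourth_power_diff_le[of "x 0" "max \<bar>x 0\<bar> \<bar>y 0\<bar>" "y 0"] by simp
qed

text \<open>\<open>L_ip\<close> admits only bounded Lipschitz functions, so the fourth power is cut
  off at the very level l at which Markov's inequality is applied. On a two-point grid coordinate 1
  is the increment, coordinate 0 the value at the first time.\<close>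

lemma truncated_fourth_power_C_bLip:
  assumes "0 < l"
  shows "(\<lambda>x. min \<bar>x 1\<bar> l ^ 4) \<in> C_bLip 2"
  unfolding C_bLip_def
proof (intro CollectI conjI exI allI)
  fix x y :: "nat \<Rightarrow> real"
  show "\<bar>min \<bar>x 1\<bar> l ^ 4\<bar> \<le> l ^ 4"
    using assms by (auto intro!: power_mono)
  have "\<bar>min \<bar>x 1\<bar> l ^ 4 - min \<bar>y 1\<bar> l ^ 4\<bar> \<le> 4 * l ^ 3 * \<bar>min \<bar>x 1\<bar> l - min \<bar>y 1\<bar> l\<bar>"
    using assms by (intro fourth_power_diff_le) auto
  also have "\<dots> \<le> 4 * l ^ 3 * L2_set (\<lambda>i. x i - y i) {..<2}"
  proof (rule mult_left_mono)
    have "\<bar>min \<bar>x 1\<bar> l - min \<bar>y 1\<bar> l\<bar> \<le> \<bar>x 1 - y 1\<bar>"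
      by linarith
    also have "\<dots> \<le> L2_set (\<lambda>i. x i - y i) {..<2}"
      using abs_le_L2_set[of 1 2 "\<lambda>i. x i - y i"] by simp
    finally show "\<bar>min \<bar>x 1\<bar> l - min \<bar>y 1\<bar> l\<bar> \<le> L2_set (\<lambda>i. x i - y i) {..<2}" .
  qed (use assms in simp)
  finally show "\<bar>min \<bar>x 1\<bar> l ^ 4 - min \<bar>y 1\<bar> l ^ 4\<bar> \<le> 4 * l ^ 3 * L2_set (\<lambda>i. x i - y i) {..<2}" .
qed

lemma truncated_abs_C_bLip: "(\<lambda>x. min \<bar>x 0\<bar> 1) \<in> C_bLip 1"
  unfolding C_bLip_def
proof (intro CollectI conjI exI allI)
  fix x y :: "nat \<Rightarrow> real"
  show "\<bar>min \<bar>x 0\<bar> 1\<bar> \<le> 1" by simp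
  have "\<bar>min \<bar>x 0\<bar> 1 - min \<bar>y 0\<bar> 1\<bar> \<le> \<bar>x 0 - y 0\<bar>"
    by linarith
  then show "\<bar>min \<bar>x 0\<bar> 1 - min \<bar>y 0\<bar> 1\<bar> \<le> 1 * L2_set (\<lambda>i. x i - y i) {..<1}"
    using abs_le_L2_set[of 0 1 "\<lambda>i. x i - y i"] by simp
qed

lemma L_ip_memI: "time_grid T n t \<Longrightarrow> \<phi> \<in> C_bLip n \<Longrightarrow> (\<lambda>\<omega>. \<phi> (increments t \<omega>)) \<in> L_ip T"
  unfolding L_ip_def by blast

context
  fixes T \<sigma>l \<sigma>u :: real and W :: "'w set" and H E' \<zeta> and E :: "rv \<Rightarrow> real"
  assumes T: "0 < T" and G: "G_expectation T \<sigma>l \<sigma>u W H E' \<zeta> E"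
begin

lemma G_sublinear: "sublinear_expectation (\<Omega> T) (L_ip T) E"
  and G_sublinear': "sublinear_expectation W H E'"
  and G_normal_in: "\<zeta> i \<in> H"
  and G_closed: "(\<And>i. i < n \<Longrightarrow> X i \<in> H) \<Longrightarrow> \<phi> \<in> C_lLip n \<Longrightarrow> (\<lambda>w. \<phi> (\<lambda>i. X i w)) \<in> H"
  and G_marginal: "time_grid T n t \<Longrightarrow> \<phi> \<in> C_bLip n \<Longrightarrow> E (\<lambda>\<omega>. \<phi> (increments t \<omega>)) =
        E' (\<lambda>w. \<phi> (\<lambda>i. sqrt (increments t (\<lambda>s. s) i) * \<zeta> i w))"
  using G unfolding G_expectation_def G_normal_iid_def sublinear_expectation_space_def G_normal_def
  by blast+

text \<open>The increment has the law of \<open>sqrt (t - s) * \<zeta> 1\<close>, whose fourth power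
  scales like \<open>(t - s)\<^sup>2\<close>, and the bound is independent of the cut-off l. A
  second moment would give only the first power of t - s, too weak for Kolmogorov's
  criterion.\<close>

lemma G_increment_moment:
  assumes st: "0 \<le> s" "s < t" "t \<le> T" and l: "0 < l"
  shows "E (\<lambda>\<omega>. min \<bar>\<omega> t - \<omega> s\<bar> l ^ 4) \<le> E' (\<lambda>w. \<zeta> 1 w ^ 4) * (t - s)\<^sup>2"
    and "(\<lambda>\<omega>. min \<bar>\<omega> t - \<omega> s\<bar> l ^ 4) \<in> L_ip T"
proof -
  let ?t = "\<lambda>i::nat. if i = 0 then s else t"
  let ?\<phi> = "\<lambda>x::nat \<Rightarrow> real. min \<bar>x 1\<bar> l ^ 4"
  have lt2: "i < 2 \<longleftrightarrow> i = 0 \<or> i = 1" for i :: nat by auto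
  have grid: "time_grid T 2 ?t"
    using st unfolding time_grid_def by (auto simp: strict_mono_on_def)
  have \<phi>: "?\<phi> \<in> C_bLip 2"
    by (rule truncated_fourth_power_C_bLip[OF l])
  have inc: "increments ?t \<omega> 1 = \<omega> t - \<omega> s" for \<omega>
    by (simp add: increments_def)
  show "(\<lambda>\<omega>. min \<bar>\<omega> t - \<omega> s\<bar> l ^ 4) \<in> L_ip T"
    using L_ip_memI[OF grid \<phi>] unfolding inc .
  have scaled: "(\<lambda>w. c * \<zeta> i w) \<in> H" for c i
    by (intro sublinear_scale_in[OF G_sublinear'] G_normal_in)
  have fourth: "(\<lambda>w. \<zeta> 1 w ^ 4) \<in> H"
    by (rule G_closed[of 1 "\<lambda>_. \<zeta> 1", OF G_normal_in fourth_power_C_lLip])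
  have "E (\<lambda>\<omega>. min \<bar>\<omega> t - \<omega> s\<bar> l ^ 4) = E' (\<lambda>w. min \<bar>sqrt (t - s) * \<zeta> 1 w\<bar> l ^ 4)"
    using G_marginal[OF grid \<phi>] unfolding inc .
  also have "\<dots> \<le> E' (\<lambda>w. (t - s)\<^sup>2 * \<zeta> 1 w ^ 4)"
  proof (rule sublinear_mono[OF G_sublinear'])
    show "(\<lambda>w. min \<bar>sqrt (t - s) * \<zeta> 1 w\<bar> l ^ 4) \<in> H"
      using G_closed[of 2 "\<lambda>i w. sqrt (t - s) * \<zeta> i w" ?\<phi>, OF scaled] \<phi> C_bLip_subset_C_lLip by blast
    show "(\<lambda>w. (t - s)\<^sup>2 * \<zeta> 1 w ^ 4) \<in> H"
      by (rule sublinear_scale_in[OF G_sublinear' fourth])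
    fix w
    have "min \<bar>sqrt (t - s) * \<zeta> 1 w\<bar> l ^ 4 \<le> \<bar>sqrt (t - s) * \<zeta> 1 w\<bar> ^ 4"
      using l by (intro power_mono) auto
    also have "\<dots> = sqrt (t - s) ^ 4 * \<zeta> 1 w ^ 4"
      by (simp add: power_mult_distrib)
    also have "sqrt (t - s) ^ 4 = (t - s)\<^sup>2"
    proof -
      have "sqrt (t - s) ^ 4 = (sqrt (t - s) ^ 2) ^ 2"
        by (simp add: power_mult[symmetric] del: real_sqrt_pow2_iff real_sqrt_pow2)
      then show ?thesis using st by simp
    qed
    finally show "min \<bar>sqrt (t - s) * \<zeta> 1 w\<bar> l ^ 4 \<le> (t - s)\<^sup>2 * \<zeta> 1 w ^ 4" .
  qed
  also have "\<dots> = (t - s)\<^sup>2 * E' (\<lambda>w. \<zeta> 1 w ^ 4)"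
    by (rule sublinear_poshom[OF G_sublinear' fourth]) simp
  finally show "E (\<lambda>\<omega>. min \<bar>\<omega> t - \<omega> s\<bar> l ^ 4) \<le> E' (\<lambda>w. \<zeta> 1 w ^ 4) * (t - s)\<^sup>2"
    by (simp add: mult.commute)
qed

lemma G_fourth_moment_nonneg: "0 \<le> E' (\<lambda>w. \<zeta> 1 w ^ 4)"
  using G_closed[of 1 "\<lambda>_. \<zeta> 1", OF G_normal_in fourth_power_C_lLip]
  by (rule sublinear_nonneg[OF G_sublinear']) simp

text \<open>On the grid consisting of time 0 alone the scaling factor is \<open>sqrt 0\<close>. The
  vanishing expectation forces paths to start at 0 almost surely under every representing
  measure.\<close>

lemma G_start:
  shows "E (\<lambda>\<omega>. min \<bar>\<omega> 0\<bar> 1) = 0" and "(\<lambda>\<omega>. min \<bar>\<omega> 0\<bar> 1) \<in> L_ip T"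
proof -
  let ?t = "\<lambda>i::nat. 0 :: real"
  have grid: "time_grid T 1 ?t"
    using T unfolding time_grid_def by (auto simp: strict_mono_on_def)
  have inc: "increments ?t \<omega> 0 = \<omega> 0" for \<omega>
    by (simp add: increments_def)
  show "(\<lambda>\<omega>. min \<bar>\<omega> 0\<bar> 1) \<in> L_ip T"
    using L_ip_memI[OF grid truncated_abs_C_bLip] unfolding inc .
  have "E (\<lambda>\<omega>. min \<bar>\<omega> 0\<bar> 1) = E' (\<lambda>w. min \<bar>sqrt 0 * \<zeta> 0 w\<bar> 1)"
    using G_marginal[OF grid truncated_abs_C_bLip] unfolding inc .
  then show "E (\<lambda>\<omega>. min \<bar>\<omega> 0\<bar> 1) = 0"
    using sublinear_const[OF G_sublinear', of 0] by simp
qed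

lemmas representing_iff = representing_measures_iff[OF G_sublinear T]

lemma representing_tail:
  assumes P: "P \<in> \<P> T E" and a: "0 < a"
  shows "measure P (\<Omega> T - kolmogorov_set T a) \<le> 5 * E' (\<lambda>w. \<zeta> 1 w ^ 4) * T\<^sup>2 / a ^ 4"
proof -
  have ps: "prob_space P" and sP: "sets P = sets (path_borel T)"
    and dom: "\<And>X. X \<in> L_ip T \<Longrightarrow> integral\<^sup>L P X \<le> E X"
    using P unfolding representing_iff by auto
  interpret prob_space P by (rule ps)
  have sp: "space P = \<Omega> T"
    using sets_eq_imp_space_eq[OF sP] by simp
  have eval: "(\<lambda>\<omega>. \<omega> t) \<in> borel_measurable P" if "t \<in> {0..T}" for t
    using path_evaluation_measurable[OF that] by (simp add: measurable_cong_sets[OF sP refl])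
  show ?thesis
  proof (rule kolmogorov_set_prob[OF T ps sP a G_fourth_moment_nonneg])
    have int: "integrable P (\<lambda>\<omega>. min \<bar>\<omega> 0\<bar> 1)"
      by (rule L_ip_integrable[OF T G_start(2) ps sP])
    have "(\<integral>\<omega>. min \<bar>\<omega> 0\<bar> 1 \<partial>P) \<le> 0"
      using dom[OF G_start(2)] G_start(1) by simp
    moreover have "0 \<le> (\<integral>\<omega>. min \<bar>\<omega> 0\<bar> 1 \<partial>P)"
      by (rule integral_nonneg_AE) auto
    ultimately have "(\<integral>\<omega>. min \<bar>\<omega> 0\<bar> 1 \<partial>P) = 0"
      by simp
    then have "AE \<omega> in P. min \<bar>\<omega> 0\<bar> 1 = 0"
      using integral_nonneg_eq_0_iff_AE[OF int] by auto
    then show "AE \<omega> in P. \<omega> 0 = 0"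
      by eventually_elim (auto simp: min_def split: if_splits)
  next
    fix s t l :: real assume st: "0 \<le> s" "s < t" "t \<le> T" and l: "0 < l"
    let ?A = "{\<omega> \<in> \<Omega> T. l < \<bar>\<omega> t - \<omega> s\<bar>}"
    have A: "?A \<in> sets P"
    proof -
      have [measurable]: "(\<lambda>\<omega>. \<omega> s) \<in> borel_measurable P" "(\<lambda>\<omega>. \<omega> t) \<in> borel_measurable P"
        using st by (auto intro: eval)
      have "{\<omega> \<in> space P. l < \<bar>\<omega> t - \<omega> s\<bar>} \<in> sets P"
        by measurable
      then show ?thesis by (simp add: sp)
    qed
    have A_int: "integrable P (\<lambda>\<omega>. l ^ 4 * indicat_real ?A \<omega>)"
      by (intro integrable_mult_right integrable_real_indicator A) (simp add: emeasure_finite less_top[symmetric])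
    \<comment> \<open>Markov's inequality: on the event the truncated fourth power equals
      \<open>l ^ 4\<close>.\<close>
    have "l ^ 4 * measure P ?A = (\<integral>\<omega>. l ^ 4 * indicat_real ?A \<omega> \<partial>P)"
      using A by simp
    also have "\<dots> \<le> (\<integral>\<omega>. min \<bar>\<omega> t - \<omega> s\<bar> l ^ 4 \<partial>P)"
      using l by (intro integral_mono A_int L_ip_integrable[OF T G_increment_moment(2)[OF st l] ps sP])
        (auto simp: indicator_def)
    also have "\<dots> \<le> E' (\<lambda>w. \<zeta> 1 w ^ 4) * (t - s)\<^sup>2"
      using dom[OF G_increment_moment(2)[OF st l]] G_increment_moment(1)[OF st l] by linarith
    finally show "measure P ?A \<le> E' (\<lambda>w. \<zeta> 1 w ^ 4) * (t - s)\<^sup>2 / l ^ 4"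
      using l by (simp add: pos_le_divide_eq mult.commute)
  qed
qed

theorem representing_measures_compact:
  fixes P :: "nat \<Rightarrow> path measure"
  assumes P: "\<And>n. P n \<in> \<P> T E"
  obtains r Q where "strict_mono r" "Q \<in> \<P> T E" "weak_convergence T (\<lambda>n. P (r n)) Q"
proof -
  define c where "c = 5 * E' (\<lambda>w. \<zeta> 1 w ^ 4) * T\<^sup>2"
  have c: "0 \<le> c"
    unfolding c_def using G_fourth_moment_nonneg by simp
  \<comment> \<open>As \<open>a m \<ge> 1\<close>, its fourth power dominates \<open>a m\<close>
    itself, so this level makes the tail at most \<open>1 / Suc m\<close>.\<close>
  define a where "a m = max 1 (c * Suc m)" for m :: nat
  have a1: "1 \<le> a m" for m
    unfolding a_def by simp
  have a: "c / a m ^ 4 \<le> 1 / Suc m" for m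
  proof -
    have "c * Suc m \<le> a m" unfolding a_def by simp
    also have "\<dots> \<le> a m ^ 4" using power_increasing[of 1 4 "a m"] a1[of m] by simp
    finally have "c * Suc m \<le> a m ^ 4" .
    moreover have "0 < a m ^ 4" using a1[of m] by simp
    ultimately show ?thesis
      by (simp add: pos_divide_le_eq pos_le_divide_eq mult.commute del: of_nat_Suc)
  qed
  have ps: "prob_space (P n)" and sP: "sets (P n) = sets (path_borel T)"
    and dom: "\<And>X. X \<in> L_ip T \<Longrightarrow> integral\<^sup>L (P n) X \<le> E X" for n
    using P[of n] unfolding representing_iff by auto
  obtain r Q where r: "strict_mono r" "prob_space Q" "sets Q = sets (path_borel T)"
    "weak_convergence T (\<lambda>n. P (r n)) Q"
  proof (rule path_prokhorov[where P=P and K="\<lambda>m. kolmogorov_set T (a m)", OF T ps sP])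
    show "kolmogorov_set T (a m) \<in> sets (path_borel T)" for m
      by (rule kolmogorov_set_measurable[OF T])
    show "measure (P n) (\<Omega> T - kolmogorov_set T (a m)) \<le> 1 / Suc m" for n m
      using representing_tail[OF P, of "a m" n] a[of m] a1[of m] unfolding c_def by linarith
    show "\<exists>s \<omega>. strict_mono s \<and> limitin (mtopology_of (path_metric T)) (\<lambda>n. x (s n)) \<omega> sequentially"
      if "\<And>n. x n \<in> kolmogorov_set T (a m)" for m and x :: "nat \<Rightarrow> path"
      using a1[of m] by (intro kolmogorov_set_compact[OF T _ that]) simp
  qed (rule that)
  \<comment> \<open>Cylinder functions are bounded and continuous, so domination passes to the weak
    limit.\<close>
  have "integral\<^sup>L Q X \<le> E X" if X: "X \<in> L_ip T" for X
  proof (rule LIMSEQ_le_const2)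
    obtain C where "\<And>\<omega>. \<bar>X \<omega>\<bar> \<le> C"
      using L_ip_bounded X by blast
    then have "bounded (X ` \<Omega> T)"
      unfolding bounded_iff by auto
    then show "(\<lambda>n. integral\<^sup>L (P (r n)) X) \<longlonglongrightarrow> integral\<^sup>L Q X"
      using r(4) L_ip_continuous[OF T X] unfolding weak_convergence_def by blast
  qed (use dom X in auto)
  then have "Q \<in> \<P> T E"
    unfolding representing_iff using r by blast
  with r show ?thesis by (intro that)
qed


subsection \<open>Stability of the maximizing measures\<close>

lemma representing_contraction:
  assumes "P \<in> \<P> T E" "X \<in> L_ip T" "Y \<in> L_ip T"
  shows "\<bar>integral\<^sup>L P X - integral\<^sup>L P Y\<bar> \<le> E (\<lambda>\<omega>. \<bar>X \<omega> - Y \<omega>\<bar>)"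
  by (rule dominated_contraction[OF G_sublinear T]) (use assms in \<open>auto simp: representing_iff\<close>)

lemmas contraction_limit = contraction_extension(2)[OF G_sublinear]

text \<open>The map taking X to \<open>E (\<lambda>\<omega>. \<bar>X \<omega>\<bar>)\<close> is
  itself a contraction, so these numbers converge and are bounded.\<close>

lemma G_Cauchy_bounded:
  assumes "Y \<in> G_Cauchy T E"
  obtains C where "\<And>n. E (\<lambda>\<omega>. \<bar>Y n \<omega>\<bar>) \<le> C"
proof -
  have "\<bar>E (\<lambda>\<omega>. \<bar>X \<omega>\<bar>) - E (\<lambda>\<omega>. \<bar>X' \<omega>\<bar>)\<bar> \<le> E (\<lambda>\<omega>. \<bar>X \<omega> - X' \<omega>\<bar>)"
    if X: "X \<in> L_ip T" "X' \<in> L_ip T" for X X'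
  proof -
    note abs_in = X[THEN sublinear_abs_in[OF G_sublinear]]
    have "\<bar>E (\<lambda>\<omega>. \<bar>X \<omega>\<bar>) - E (\<lambda>\<omega>. \<bar>X' \<omega>\<bar>)\<bar> \<le> E (\<lambda>\<omega>. \<bar>\<bar>X \<omega>\<bar> - \<bar>X' \<omega>\<bar>\<bar>)"
      by (rule sublinear_contraction[OF G_sublinear abs_in])
    also have "\<dots> \<le> E (\<lambda>\<omega>. \<bar>X \<omega> - X' \<omega>\<bar>)"
      by (rule sublinear_mono[OF G_sublinear sublinear_absdiff_in[OF G_sublinear abs_in]
            sublinear_absdiff_in[OF G_sublinear X]]) linarith
    finally show ?thesis .
  qed
  from contraction_limit[where F="\<lambda>X. E (\<lambda>\<omega>. \<bar>X \<omega>\<bar>)", OF this assms]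
  have "Bseq (\<lambda>n. E (\<lambda>\<omega>. \<bar>Y n \<omega>\<bar>))"
    by (intro convergent_imp_Bseq convergentI)
  then obtain C where "\<And>n. norm (E (\<lambda>\<omega>. \<bar>Y n \<omega>\<bar>)) \<le> C"
    unfolding Bseq_def by blast
  then show ?thesis
    using that abs_le_D1 unfolding real_norm_def by blast
qed

text \<open>C depends on Y alone, so the effect of the perturbation is bounded by the same number
  for \<open>E\<close> and for all representing measures.\<close>

lemma contraction_extension_perturbed:
  assumes F: "\<And>X Y. X \<in> L_ip T \<Longrightarrow> Y \<in> L_ip T \<Longrightarrow> \<bar>F X - F Y\<bar> \<le> E (\<lambda>\<omega>. \<bar>X \<omega> - Y \<omega>\<bar>)"
    and X: "X \<in> G_Cauchy T E" and Y: "Y \<in> G_Cauchy T E"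
    and C: "\<And>n. E (\<lambda>\<omega>. \<bar>Y n \<omega>\<bar>) \<le> C" and \<epsilon>: "0 \<le> \<epsilon>"
  shows "\<bar>extension F (G_rel T E `` {\<lambda>n \<omega>. X n \<omega> + \<epsilon> * Y n \<omega>}) - extension F (G_rel T E `` {X})\<bar> \<le> \<epsilon> * C"
proof (rule LIMSEQ_le_const2)
  note XY = G_Cauchy_lincomb[OF G_sublinear X Y, of \<epsilon>]
  note L = G_Cauchy_D[OF G_sublinear X] G_Cauchy_D[OF G_sublinear XY] G_Cauchy_D[OF G_sublinear Y]
  show "(\<lambda>n. \<bar>F (\<lambda>\<omega>. X n \<omega> + \<epsilon> * Y n \<omega>) - F (X n)\<bar>) \<longlonglongrightarrow>
      \<bar>extension F (G_rel T E `` {\<lambda>n \<omega>. X n \<omega> + \<epsilon> * Y n \<omega>}) - extension F (G_rel T E `` {X})\<bar>"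
    by (intro tendsto_rabs tendsto_diff contraction_limit[where F=F, OF F XY] contraction_limit[where F=F, OF F X])
  have "\<bar>F (\<lambda>\<omega>. X n \<omega> + \<epsilon> * Y n \<omega>) - F (X n)\<bar> \<le> \<epsilon> * C" for n
  proof -
    have "\<bar>F (\<lambda>\<omega>. X n \<omega> + \<epsilon> * Y n \<omega>) - F (X n)\<bar> \<le> E (\<lambda>\<omega>. \<bar>X n \<omega> + \<epsilon> * Y n \<omega> - X n \<omega>\<bar>)"
      by (rule F[OF L(2,1)])
    also have "\<dots> = E (\<lambda>\<omega>. \<epsilon> * \<bar>Y n \<omega>\<bar>)"
      using \<epsilon> by (simp add: abs_mult)
    also have "\<dots> = \<epsilon> * E (\<lambda>\<omega>. \<bar>Y n \<omega>\<bar>)"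
      by (rule sublinear_poshom[OF G_sublinear sublinear_abs_in[OF G_sublinear L(3)] \<epsilon>])
    also have "\<dots> \<le> \<epsilon> * C"
      by (rule mult_left_mono[OF C \<epsilon>])
    finally show ?thesis .
  qed
  then show "\<exists>N. \<forall>n\<ge>N. \<bar>F (\<lambda>\<omega>. X n \<omega> + \<epsilon> * Y n \<omega>) - F (X n)\<bar> \<le> \<epsilon> * C"
    by blast
qed

text \<open>Removing the perturbation costs \<open>\<epsilon> * C\<close> once under P and once
  under the G-expectation, hence the factor 2.\<close>

lemma maximizer_perturbed:
  assumes X: "X \<in> G_Cauchy T E" and Y: "Y \<in> G_Cauchy T E"
    and C: "\<And>n. E (\<lambda>\<omega>. \<bar>Y n \<omega>\<bar>) \<le> C" and \<epsilon>: "0 \<le> \<epsilon>"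
    and P: "P \<in> \<P>_max T E (G_rel T E `` {\<lambda>n \<omega>. X n \<omega> + \<epsilon> * Y n \<omega>})"
  shows "extension E (G_rel T E `` {X}) - 2 * (\<epsilon> * C) \<le> extension (integral\<^sup>L P) (G_rel T E `` {X})"
proof -
  have P': "P \<in> \<P> T E"
    using P unfolding \<P>_max_def by simp
  show ?thesis
    using contraction_extension_perturbed[where F=E, OF sublinear_contraction[OF G_sublinear] X Y C \<epsilon>]
      contraction_extension_perturbed[where F="integral\<^sup>L P", OF representing_contraction[OF P'] X Y C \<epsilon>] P
    unfolding \<P>_max_def by auto
qed

text \<open>An element of the completion is only a limit of bounded continuous functions, but the
  error of replacing it by \<open>X N\<close> is dominated by \<open>E\<close> and so uniform over
  the representing measures. Two such errors and one weak limit take e / 3 each.\<close>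

lemma extension_tendsto:
  assumes X: "X \<in> G_Cauchy T E" and P: "\<And>k. P k \<in> \<P> T E" and Q: "Q \<in> \<P> T E"
    and wc: "weak_convergence T P Q"
  shows "(\<lambda>k. extension (integral\<^sup>L (P k)) (G_rel T E `` {X})) \<longlonglongrightarrow> extension (integral\<^sup>L Q) (G_rel T E `` {X})"
proof (rule LIMSEQ_I)
  fix e :: real assume "e > 0"
  then obtain N where N: "\<And>m n. m \<ge> N \<Longrightarrow> n \<ge> N \<Longrightarrow> E (\<lambda>\<omega>. \<bar>X m \<omega> - X n \<omega>\<bar>) < e / 3"
    using G_Cauchy_E[OF G_sublinear X, of "e / 3"] by auto
  note L = G_Cauchy_D[OF G_sublinear X]
  have close: "\<bar>integral\<^sup>L R (X N) - extension (integral\<^sup>L R) (G_rel T E `` {X})\<bar> \<le> e / 3" if R: "R \<in> \<P> T E" for R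
  proof (rule LIMSEQ_le_const2)
    show "(\<lambda>n. \<bar>integral\<^sup>L R (X N) - integral\<^sup>L R (X n)\<bar>) \<longlonglongrightarrow>
        \<bar>integral\<^sup>L R (X N) - extension (integral\<^sup>L R) (G_rel T E `` {X})\<bar>"
      by (intro tendsto_rabs tendsto_diff tendsto_const
          contraction_limit[where F="integral\<^sup>L R", OF representing_contraction[OF R] X])
    have "\<bar>integral\<^sup>L R (X N) - integral\<^sup>L R (X n)\<bar> \<le> e / 3" if "n \<ge> N" for n
      using representing_contraction[OF R L[of N] L[of n]] N[OF order_refl that] by linarith
    then show "\<exists>M. \<forall>n\<ge>M. \<bar>integral\<^sup>L R (X N) - integral\<^sup>L R (X n)\<bar> \<le> e / 3"
      by blast
  qed
  obtain C where "\<And>\<omega>. \<bar>X N \<omega>\<bar> \<le> C"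
    using L_ip_bounded L by blast
  then have "bounded (X N ` \<Omega> T)"
    unfolding bounded_iff by auto
  then have "(\<lambda>k. integral\<^sup>L (P k) (X N)) \<longlonglongrightarrow> integral\<^sup>L Q (X N)"
    using wc L_ip_continuous[OF T L] unfolding weak_convergence_def by blast
  then obtain M where M: "\<And>k. k \<ge> M \<Longrightarrow> \<bar>integral\<^sup>L (P k) (X N) - integral\<^sup>L Q (X N)\<bar> < e / 3"
    using \<open>e > 0\<close> unfolding LIMSEQ_def dist_real_def by (meson divide_pos_pos zero_less_numeral)
  have "norm (extension (integral\<^sup>L (P k)) (G_rel T E `` {X}) - extension (integral\<^sup>L Q) (G_rel T E `` {X})) < e"
    if "k \<ge> M" for k
    using close[OF P[of k]] close[OF Q] M[OF that] unfolding real_norm_def by linarith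
  then show "\<exists>M. \<forall>k\<ge>M. norm (extension (integral\<^sup>L (P k)) (G_rel T E `` {X}) - extension (integral\<^sup>L Q) (G_rel T E `` {X})) < e"
    by blast
qed

end

theorem proposition4p2:
  fixes T \<sigma>l \<sigma>u :: real
    and W :: "'w set" and H :: "('w \<Rightarrow> real) set" and E' :: "('w \<Rightarrow> real) \<Rightarrow> real"
    and \<zeta> :: "nat \<Rightarrow> 'w \<Rightarrow> real"
    and E :: "rv \<Rightarrow> real"
    and d :: "path measure \<Rightarrow> path measure \<Rightarrow> real"
    and \<xi> \<eta> :: "(nat \<Rightarrow> rv) set"
  assumes "0 < T" and "0 < \<sigma>l" and "\<sigma>l \<le> \<sigma>u"
    and "G_expectation T \<sigma>l \<sigma>u W H E' \<zeta> E"
    and "compatible_metric T (\<P> T E) d"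
    and "\<xi> \<in> L_G1 T E" and "\<eta> \<in> L_G1 T E"
  shows "((\<lambda>\<epsilon>. \<Gamma> d (\<P>_max T E (L_G1_add T E \<xi> (L_G1_scale T E \<epsilon> \<eta>))) (\<P>_max T E \<xi>))
           \<longlongrightarrow> 0) (at_right (0::real))"
proof (rule order_tendstoI)
  note T = \<open>0 < T\<close> and G = \<open>G_expectation T \<sigma>l \<sigma>u W H E' \<zeta> E\<close>
  note SE = G_sublinear[OF T G]
  obtain X where X: "X \<in> G_Cauchy T E" and \<xi>: "\<xi> = G_rel T E `` {X}"
    using L_G1_cases[OF SE \<open>\<xi> \<in> L_G1 T E\<close>] by blast
  obtain Y where Y: "Y \<in> G_Cauchy T E" and \<eta>: "\<eta> = G_rel T E `` {Y}"
    using L_G1_cases[OF SE \<open>\<eta> \<in> L_G1 T E\<close>] by blast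
  obtain C where C: "\<And>n. E (\<lambda>\<omega>. \<bar>Y n \<omega>\<bar>) \<le> C"
    using G_Cauchy_bounded[OF T G Y] by blast
  let ?M = "\<lambda>\<epsilon>. \<P>_max T E (G_rel T E `` {\<lambda>n \<omega>. X n \<omega> + \<epsilon> * Y n \<omega>})"
  have M: "\<P>_max T E (L_G1_add T E \<xi> (L_G1_scale T E \<epsilon> \<eta>)) = ?M \<epsilon>" for \<epsilon>
    unfolding \<xi> \<eta> by (simp only: L_G1_lincomb_class[OF SE X Y])
  fix a :: ennreal assume "0 < a"
  \<comment> \<open>A strictly smaller level: a supremum of at least a need not be attained, but
    some measure then has distance greater than \<delta>.\<close>
  then obtain \<delta> where \<delta>: "0 < \<delta>" "\<delta> < a"
    using dense by blast
  show "\<forall>\<^sub>F \<epsilon> in at_right 0. \<Gamma> d (\<P>_max T E (L_G1_add T E \<xi> (L_G1_scale T E \<epsilon> \<eta>))) (\<P>_max T E \<xi>) < a"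
    unfolding M
  proof (rule ccontr)
    assume "\<not> (\<forall>\<^sub>F \<epsilon> in at_right 0. \<Gamma> d (?M \<epsilon>) (\<P>_max T E \<xi>) < a)"
    then have bad: "\<exists>\<epsilon>>0. \<epsilon> < b \<and> a \<le> \<Gamma> d (?M \<epsilon>) (\<P>_max T E \<xi>)" if "0 < b" for b :: real
      using that unfolding eventually_at_right[OF zero_less_one] by (auto simp: not_less dest: spec[of _ b])
    have "\<exists>\<epsilon> P. 0 < \<epsilon> \<and> \<epsilon> < 1 / Suc k \<and> P \<in> ?M \<epsilon> \<and> \<delta> < dist_to_set d P (\<P>_max T E \<xi>)" for k
    proof -
      obtain \<epsilon> where \<epsilon>: "0 < \<epsilon>" "\<epsilon> < 1 / Suc k" "a \<le> \<Gamma> d (?M \<epsilon>) (\<P>_max T E \<xi>)"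
        using bad[of "1 / Suc k"] by auto
      from \<delta>(2) \<epsilon>(3) have "\<delta> < \<Gamma> d (?M \<epsilon>) (\<P>_max T E \<xi>)"
        by (rule less_le_trans)
      with \<epsilon> show ?thesis
        unfolding \<Gamma>_def less_SUP_iff by blast
    qed
    from choice[OF allI[OF this]] obtain \<epsilon> where
      "\<forall>k. \<exists>P. 0 < \<epsilon> k \<and> \<epsilon> k < 1 / Suc k \<and> P \<in> ?M (\<epsilon> k) \<and> \<delta> < dist_to_set d P (\<P>_max T E \<xi>)"
      by (rule exE)
    from choice[OF this] obtain P where
      "\<forall>k. 0 < \<epsilon> k \<and> \<epsilon> k < 1 / Suc k \<and> P k \<in> ?M (\<epsilon> k) \<and> \<delta> < dist_to_set d (P k) (\<P>_max T E \<xi>)"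
      by (rule exE)
    then have \<epsilon>: "0 < \<epsilon> k" "\<epsilon> k < 1 / Suc k"
      and P: "P k \<in> ?M (\<epsilon> k)" "\<delta> < dist_to_set d (P k) (\<P>_max T E \<xi>)" for k
      by blast+
    have P': "P k \<in> \<P> T E" for k
      using P(1)[of k] unfolding \<P>_max_def by simp
    obtain r Q where r: "strict_mono r" and Q: "Q \<in> \<P> T E" and wc: "weak_convergence T (\<lambda>k. P (r k)) Q"
    proof (rule representing_measures_compact[OF T G, of P])
      show "P k \<in> \<P> T E" for k
        by (rule P')
    qed (rule that)
    have "\<epsilon> \<longlonglongrightarrow> 0"
      by (rule tendsto_sandwich[OF _ _ tendsto_const LIMSEQ_Suc[OF lim_1_over_n]])
        (use \<epsilon> in \<open>auto intro!: always_eventually less_imp_le simp del: of_nat_Suc\<close>)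
    from LIMSEQ_subseq_LIMSEQ[OF this r] have "(\<lambda>k. \<epsilon> (r k)) \<longlonglongrightarrow> 0"
      by (simp add: o_def)
    then have "(\<lambda>k. extension E \<xi> - 2 * (\<epsilon> (r k) * C)) \<longlonglongrightarrow> extension E \<xi> - 2 * (0 * C)"
      by (intro tendsto_intros)
    then have "extension E \<xi> - 2 * (0 * C) \<le> extension (integral\<^sup>L Q) \<xi>"
      unfolding \<xi>
      by (rule LIMSEQ_le[OF _ extension_tendsto[OF T G X P' Q wc]])
        (use maximizer_perturbed[OF T G X Y C less_imp_le[OF \<epsilon>(1)] P(1)] in blast)
    moreover have "extension (integral\<^sup>L Q) \<xi> \<le> extension E \<xi>"
      using Q \<open>\<xi> \<in> L_G1 T E\<close> unfolding \<P>_def by blast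
    ultimately have Q_max: "Q \<in> \<P>_max T E \<xi>"
      unfolding \<P>_max_def using Q by simp
    have "(\<lambda>k. d (P (r k)) Q) \<longlonglongrightarrow> 0"
      using \<open>compatible_metric T (\<P> T E) d\<close>[unfolded compatible_metric_def, THEN conjunct2,
          THEN spec, THEN spec, of "\<lambda>k. P (r k)" Q] P' Q wc by simp
    then have "(\<lambda>k. ennreal (d (P (r k)) Q)) \<longlonglongrightarrow> ennreal 0"
      by (rule tendsto_ennrealI)
    \<comment> \<open>Q itself maximizes \<xi>, so the distance of each measure to that set is at
      most its distance to Q.\<close>
    moreover have "\<delta> \<le> ennreal (d (P (r k)) Q)" for k
      using P(2)[of "r k"] INF_lower[OF Q_max, of "\<lambda>Q. ennreal (d (P (r k)) Q)"]
      unfolding dist_to_set_def by (rule less_imp_le[OF less_le_trans])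
    ultimately have "\<delta> \<le> ennreal 0"
      by (intro LIMSEQ_le_const) auto
    with \<delta>(1) show False
      by simp
  qed
\<comment> \<open>Nothing in \<open>ennreal\<close> lies below 0, so the lower half of the limit is
  vacuous.\<close>
qed simp

end
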